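(* Every finite lattice $K$ has a congruence-preserving extension to a finite isoform lattice $L$; that is, for every finite lattice $K$ there exists a finite isoform lattice $L$ which is a congruence-preserving extension of $K$.
   Context: Let $L$ be a lattice. A congruence relation $\Theta$ of $L$ is called isoform if any two congruence classes of $\Theta$ are isomorphic as lattices (each congruence class being regarded as a sublattice of $L$). The lattice $L$ is called isoform if all congruences of $L$ are isoform. Let $K$ be a finite lattice. A finite lattice $L$ is a congruence-preserving extension of $K$ if $L$ is an extension of $K$ (i.e. $K$ is, up to isomorphism, a sublattice of $L$) and every congruence $\Theta$ of $K$ has exactly one extension $\overline{\Theta}$ to $L$, that is, there is exactly one congruence $\overline{\Theta}$ of $L$ whose restriction to $K$ satisfies $\overline{\Theta}|_K = \Theta$. *)

theory Defs
  imports "HOL-Algebra.Lattice"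
begin

definition finite_lattice :: "('a, 'm) gorder_scheme \<Rightarrow> bool" where
  "finite_lattice L \<longleftrightarrow> lattice L \<and> finite (carrier L) \<and> carrier L \<noteq> {}"

definition lattice_hom ::
    "('a, 'm) gorder_scheme \<Rightarrow> ('b, 'n) gorder_scheme \<Rightarrow> ('a \<Rightarrow> 'b) set" where
  "lattice_hom L M = {f \<in> carrier L \<rightarrow> carrier M. join_pres L M f \<and> meet_pres L M f}"

definition lattice_isomorphic ::
    "('a, 'm) gorder_scheme \<Rightarrow> ('b, 'n) gorder_scheme \<Rightarrow> bool" where
  "lattice_isomorphic L M \<longleftrightarrow>
     (\<exists>f \<in> lattice_hom L M. bij_betw f (carrier L) (carrier M))"

definition lattice_embedding ::
    "('a, 'm) gorder_scheme \<Rightarrow> ('b, 'n) gorder_scheme \<Rightarrow> ('a \<Rightarrow> 'b) \<Rightarrow> bool" where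
  "lattice_embedding L M f \<longleftrightarrow> f \<in> lattice_hom L M \<and> inj_on f (carrier L)"

definition lattice_congruence :: "('a, 'm) gorder_scheme \<Rightarrow> 'a rel \<Rightarrow> bool" where
  "lattice_congruence L \<Theta> \<longleftrightarrow> equiv (carrier L) \<Theta> \<and>
     (\<forall>x y u v. (x, y) \<in> \<Theta> \<longrightarrow> (u, v) \<in> \<Theta> \<longrightarrow>
        (x \<squnion>\<^bsub>L\<^esub> u, y \<squnion>\<^bsub>L\<^esub> v) \<in> \<Theta> \<and> (x \<sqinter>\<^bsub>L\<^esub> u, y \<sqinter>\<^bsub>L\<^esub> v) \<in> \<Theta>)"

text \<open>
  A congruence class \<open>A\<close> is regarded as a lattice by restricting the order of \<open>L\<close> to \<open>A\<close>.
  As \<open>A\<close> is closed under the operations of \<open>L\<close>, this is the sublattice of \<open>L\<close> on \<open>A\<close>; see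
  the lemma \<open>congruence_class_sublattice\<close>.
\<close>

definition isoform_congruence :: "('a, 'm) gorder_scheme \<Rightarrow> 'a rel \<Rightarrow> bool" where
  "isoform_congruence L \<Theta> \<longleftrightarrow>
     (\<forall>A \<in> carrier L // \<Theta>. \<forall>B \<in> carrier L // \<Theta>.
        lattice_isomorphic (L\<lparr>carrier := A\<rparr>) (L\<lparr>carrier := B\<rparr>))"

definition isoform :: "('a, 'm) gorder_scheme \<Rightarrow> bool" where
  "isoform L \<longleftrightarrow> (\<forall>\<Theta>. lattice_congruence L \<Theta> \<longrightarrow> isoform_congruence L \<Theta>)"

text \<open>
  The restriction to \<open>K\<close> of a relation on an extension of \<open>K\<close>, where \<open>K\<close> is identified with
  its image under \<open>f\<close>.
\<close>

definition restrict_along :: "('a, 'm) gorder_scheme \<Rightarrow> ('a \<Rightarrow> 'b) \<Rightarrow> 'b rel \<Rightarrow> 'a rel" where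
  "restrict_along K f \<Psi> = {(x, y) \<in> carrier K \<times> carrier K. (f x, f y) \<in> \<Psi>}"

definition congruence_preserving_extension ::
    "('a, 'm) gorder_scheme \<Rightarrow> ('b, 'n) gorder_scheme \<Rightarrow> bool" where
  "congruence_preserving_extension K L \<longleftrightarrow>
     (\<exists>f. lattice_embedding K L f \<and>
        (\<forall>\<Theta>. lattice_congruence K \<Theta> \<longrightarrow>
           (\<exists>!\<Psi>. lattice_congruence L \<Psi> \<and> restrict_along K f \<Psi> = \<Theta>)))"

lemma congruence_class_sublattice:
  assumes L: "lattice L" and C: "lattice_congruence L \<Theta>" and A: "A \<in> carrier L // \<Theta>"
  shows "lattice (L\<lparr>carrier := A\<rparr>)"
    and "\<lbrakk>x \<in> A; y \<in> A\<rbrakk> \<Longrightarrow> x \<squnion>\<^bsub>L\<lparr>carrier := A\<rparr>\<^esub> y = x \<squnion>\<^bsub>L\<^esub> y \<and> x \<squnion>\<^bsub>L\<^esub> y \<in> A"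
    and "\<lbrakk>x \<in> A; y \<in> A\<rbrakk> \<Longrightarrow> x \<sqinter>\<^bsub>L\<lparr>carrier := A\<rparr>\<^esub> y = x \<sqinter>\<^bsub>L\<^esub> y \<and> x \<sqinter>\<^bsub>L\<^esub> y \<in> A"
proof -
  interpret lattice L by fact
  let ?A = "L\<lparr>carrier := A\<rparr>"
  have eq: "equiv (carrier L) \<Theta>" using C by (simp add: lattice_congruence_def)
  have sub: "A \<subseteq> carrier L" using A eq by (metis Union_quotient Union_upper)
  have A_rel: "(x, y) \<in> \<Theta>" if "x \<in> A" "y \<in> A" for x y
    using quotient_eq_iff[OF eq A A that] by simp
  have A_mem: "y \<in> A" if "x \<in> A" "(x, y) \<in> \<Theta>" for x y
    using in_quotient_imp_closed[OF eq A that] .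
  have jA: "x \<squnion>\<^bsub>L\<^esub> y \<in> A" and mA: "x \<sqinter>\<^bsub>L\<^esub> y \<in> A" if "x \<in> A" "y \<in> A" for x y
  proof -
    have "(x \<squnion>\<^bsub>L\<^esub> x, x \<squnion>\<^bsub>L\<^esub> y) \<in> \<Theta>" "(x \<sqinter>\<^bsub>L\<^esub> x, x \<sqinter>\<^bsub>L\<^esub> y) \<in> \<Theta>"
      using C A_rel that unfolding lattice_congruence_def by blast+
    moreover have "x \<squnion>\<^bsub>L\<^esub> x = x" "x \<sqinter>\<^bsub>L\<^esub> x = x"
      using that sub le_iff_join[of x x] le_iff_meet[of x x] by auto
    ultimately show "x \<squnion>\<^bsub>L\<^esub> y \<in> A" "x \<sqinter>\<^bsub>L\<^esub> y \<in> A"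
      using A_mem that by auto
  qed
  have lub: "least ?A (x \<squnion>\<^bsub>L\<^esub> y) (Upper ?A {x, y})" if "x \<in> A" "y \<in> A" for x y
    using that jA[OF that] sub join_left[of x y] join_right[of x y] join_le[of x _ y]
    by (auto simp: least_def Upper_def subset_iff)
  have glb: "greatest ?A (x \<sqinter>\<^bsub>L\<^esub> y) (Lower ?A {x, y})" if "x \<in> A" "y \<in> A" for x y
    using that mA[OF that] sub meet_left[of x y] meet_right[of x y] meet_le[of _ x y]
    by (auto simp: greatest_def Lower_def subset_iff)
  have po: "partial_order ?A"
    using sub eq_is_equal
    by unfold_locales (auto simp: subset_iff intro: le_trans le_antisym)
  interpret A: partial_order ?A by (fact po)
  show "lattice ?A"
  proof unfold_locales
    fix x y
    assume "x \<in> carrier ?A" "y \<in> carrier ?A"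
    then have xy: "x \<in> A" "y \<in> A" by simp_all
    show "\<exists>s. least ?A s (Upper ?A {x, y})" by (rule exI, rule lub[OF xy])
    show "\<exists>s. greatest ?A s (Lower ?A {x, y})" by (rule exI, rule glb[OF xy])
  qed
  show "x \<squnion>\<^bsub>?A\<^esub> y = x \<squnion>\<^bsub>L\<^esub> y \<and> x \<squnion>\<^bsub>L\<^esub> y \<in> A" if "x \<in> A" "y \<in> A"
  proof -
    have "least ?A (\<Squnion>\<^bsub>?A\<^esub>{x, y}) (Upper ?A {x, y})"
      unfolding sup_def using lub[OF that] by (rule someI)
    then have "\<Squnion>\<^bsub>?A\<^esub>{x, y} = x \<squnion>\<^bsub>L\<^esub> y"
      using lub[OF that] by (rule A.least_unique)
    then show ?thesis using jA[OF that] by (simp add: join_def)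
  qed
  show "x \<sqinter>\<^bsub>?A\<^esub> y = x \<sqinter>\<^bsub>L\<^esub> y \<and> x \<sqinter>\<^bsub>L\<^esub> y \<in> A" if "x \<in> A" "y \<in> A"
  proof -
    have "greatest ?A (\<Sqinter>\<^bsub>?A\<^esub>{x, y}) (Lower ?A {x, y})"
      unfolding inf_def using glb[OF that] by (rule someI)
    then have "\<Sqinter>\<^bsub>?A\<^esub>{x, y} = x \<sqinter>\<^bsub>L\<^esub> y"
      using glb[OF that] by (rule A.greatest_unique)
    then show ?thesis using mA[OF that] by (simp add: meet_def)
  qed
qed

end

theory Submission
  imports Defs
begin

text \<open>
  Let \<open>M\<close> be the set of all congruences \<open>\<phi>\<close> of \<open>K\<close> that are the largest congruence separating some
  pair of elements. Every congruence is the intersection of the members of \<open>M\<close> above it, and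
  every member of \<open>M\<close> is meet-prime, so congruences of \<open>K\<close> correspond to up-sets of \<open>M\<close>.
  Each quotient of \<open>K\<close> by \<open>\<phi> \<in> M\<close> is embedded into a simple lattice \<open>A \<phi>\<close> with an additional element
  \<open>v \<phi>\<close> covering the bottom and covered by the top. On the product of the \<open>A \<phi>\<close> the order is pruned:
  if \<open>\<psi> \<subset> \<phi>\<close>, then two elements that differ at \<open>\<phi>\<close> and both take the value \<open>v \<psi>\<close> at \<open>\<psi>\<close> become
  incomparable. The result is a lattice in which a congruence collapsing something at \<open>\<phi>\<close> collapses
  everything at \<open>\<psi>\<close>; hence its congruences are exactly the relations ``equal on the coordinates in
  an up-set of \<open>M\<close>''. The classes of such a relation are isomorphic, since the pruning condition
  within a class refers only to the coordinates outside the up-set. Finally, \<open>K\<close> embeds diagonally,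
  because its image avoids the elements \<open>v \<phi>\<close> and the operations are componentwise there.
\<close>

section \<open>Lattices and their congruences\<close>

text \<open>Serves orders whose joins and meets come as explicit operations: only bounding
  properties have to be checked, no lattice identities.\<close>

lemma (in partial_order) latticeI:
  assumes j: "\<And>x y. \<lbrakk>x \<in> carrier L; y \<in> carrier L\<rbrakk> \<Longrightarrow> j x y \<in> carrier L \<and> x \<sqsubseteq> j x y \<and> y \<sqsubseteq> j x y"
    and j_least: "\<And>x y w. \<lbrakk>x \<in> carrier L; y \<in> carrier L; w \<in> carrier L; x \<sqsubseteq> w; y \<sqsubseteq> w\<rbrakk> \<Longrightarrow> j x y \<sqsubseteq> w"
    and m: "\<And>x y. \<lbrakk>x \<in> carrier L; y \<in> carrier L\<rbrakk> \<Longrightarrow> m x y \<in> carrier L \<and> m x y \<sqsubseteq> x \<and> m x y \<sqsubseteq> y"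
    and m_greatest: "\<And>x y w. \<lbrakk>x \<in> carrier L; y \<in> carrier L; w \<in> carrier L; w \<sqsubseteq> x; w \<sqsubseteq> y\<rbrakk> \<Longrightarrow> w \<sqsubseteq> m x y"
  shows "lattice L"
proof -
  have "\<exists>s. least L s (Upper L {x, y})" if "x \<in> carrier L" "y \<in> carrier L" for x y
  proof -
    have "j x y \<sqsubseteq> w" if "w \<in> Upper L {x, y}" for w
      using that \<open>x \<in> carrier L\<close> \<open>y \<in> carrier L\<close> by (intro j_least) (auto simp: Upper_def)
    with j[OF that] that have "least L (j x y) (Upper L {x, y})"
      unfolding least_def Upper_def by blast
    then show ?thesis ..
  qed
  moreover have "\<exists>s. greatest L s (Lower L {x, y})" if "x \<in> carrier L" "y \<in> carrier L" for x y
  proof -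
    have "w \<sqsubseteq> m x y" if "w \<in> Lower L {x, y}" for w
      using that \<open>x \<in> carrier L\<close> \<open>y \<in> carrier L\<close> by (intro m_greatest) (auto simp: Lower_def)
    with m[OF that] that have "greatest L (m x y) (Lower L {x, y})"
      unfolding greatest_def Lower_def by blast
    then show ?thesis ..
  qed
  ultimately show ?thesis
    by (intro lattice.intro upper_semilattice.intro lower_semilattice.intro partial_order_axioms)
      (simp_all add: upper_semilattice_axioms_def lower_semilattice_axioms_def)
qed

text \<open>The \<open>eq\<close> field of a \<open>gorder\<close> may be any equivalence; with true
  equality in its place only the three usual order laws remain.\<close>

lemma partial_orderI_eq:
  assumes "eq L = (=)"
    and "\<And>x. x \<in> carrier L \<Longrightarrow> x \<sqsubseteq>\<^bsub>L\<^esub> x"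
    and "\<And>x y. \<lbrakk>x \<in> carrier L; y \<in> carrier L; x \<sqsubseteq>\<^bsub>L\<^esub> y; y \<sqsubseteq>\<^bsub>L\<^esub> x\<rbrakk> \<Longrightarrow> x = y"
    and "\<And>x y z. \<lbrakk>x \<in> carrier L; y \<in> carrier L; z \<in> carrier L; x \<sqsubseteq>\<^bsub>L\<^esub> y; y \<sqsubseteq>\<^bsub>L\<^esub> z\<rbrakk> \<Longrightarrow> x \<sqsubseteq>\<^bsub>L\<^esub> z"
  shows "partial_order L"
proof unfold_locales
  show "x \<sqsubseteq>\<^bsub>L\<^esub> z"
    if "x \<sqsubseteq>\<^bsub>L\<^esub> y" "y \<sqsubseteq>\<^bsub>L\<^esub> z" "x \<in> carrier L" "y \<in> carrier L" "z \<in> carrier L" for x y z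
    using that assms(4)[of x y z] by blast
qed (simp_all add: assms(1-3))

text \<open>Duality exchanges the two semilattice halves, so statements about meets can later be
  read off from statements about joins.\<close>

lemma lattice_dual_iff: "lattice (inv_gorder L) \<longleftrightarrow> lattice L"
  by (auto simp: lattice_def upper_semilattice_def lower_semilattice_def dual_order_iff
      upper_semilattice_axioms_def lower_semilattice_axioms_def)

context lattice
begin

lemma join_eqI:
  assumes "x \<in> carrier L" "y \<in> carrier L" "z \<in> carrier L" "x \<sqsubseteq> z" "y \<sqsubseteq> z"
    and "\<And>w. \<lbrakk>w \<in> carrier L; x \<sqsubseteq> w; y \<sqsubseteq> w\<rbrakk> \<Longrightarrow> z \<sqsubseteq> w"
  shows "x \<squnion> y = z"
  using assms join_left join_right join_le by (intro le_antisym) auto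

lemma meet_eqI:
  assumes "x \<in> carrier L" "y \<in> carrier L" "z \<in> carrier L" "z \<sqsubseteq> x" "z \<sqsubseteq> y"
    and "\<And>w. \<lbrakk>w \<in> carrier L; w \<sqsubseteq> x; w \<sqsubseteq> y\<rbrakk> \<Longrightarrow> w \<sqsubseteq> z"
  shows "x \<sqinter> y = z"
  using assms meet_left meet_right meet_le by (intro le_antisym) auto

lemma join_absorb: "\<lbrakk>x \<sqsubseteq> y; x \<in> carrier L; y \<in> carrier L\<rbrakk> \<Longrightarrow> x \<squnion> y = y"
  by (rule join_eqI) auto

lemma meet_absorb: "\<lbrakk>x \<sqsubseteq> y; x \<in> carrier L; y \<in> carrier L\<rbrakk> \<Longrightarrow> x \<sqinter> y = x"
  by (rule meet_eqI) auto

lemma join_absorb2: "\<lbrakk>x \<sqsubseteq> y; x \<in> carrier L; y \<in> carrier L\<rbrakk> \<Longrightarrow> y \<squnion> x = y"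
  by (rule join_eqI) auto

lemma meet_absorb2: "\<lbrakk>x \<sqsubseteq> y; x \<in> carrier L; y \<in> carrier L\<rbrakk> \<Longrightarrow> y \<sqinter> x = x"
  by (rule meet_eqI) auto

lemma join_idem: "x \<in> carrier L \<Longrightarrow> x \<squnion> x = x"
  by (rule join_absorb) auto

lemma meet_idem: "x \<in> carrier L \<Longrightarrow> x \<sqinter> x = x"
  by (rule meet_absorb) auto

lemma meet_le_join: "\<lbrakk>x \<in> carrier L; y \<in> carrier L\<rbrakk> \<Longrightarrow> x \<sqinter> y \<sqsubseteq> x \<squnion> y"
  by (meson join_closed join_left le_trans meet_closed meet_left)

lemma meet_eq_join_imp_eq:
  assumes "x \<in> carrier L" "y \<in> carrier L" "x \<sqinter> y = x \<squnion> y"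
  shows "x = y"
  using join_left[OF assms(1,2)] join_right[OF assms(1,2)] meet_left[OF assms(1,2)] meet_right[OF assms(1,2)]
  unfolding assms(3) by (metis assms(1,2) join_closed le_antisym)

end

text \<open>Joins and meets are determined by the order, and surjectivity lets every upper or lower
  bound in \<open>M\<close> be pulled back to \<open>L\<close>.\<close>

lemma order_iso_lattice_hom:
  assumes L: "lattice L" and M: "lattice M" and f: "bij_betw f (carrier L) (carrier M)"
    and le: "\<And>x y. \<lbrakk>x \<in> carrier L; y \<in> carrier L\<rbrakk> \<Longrightarrow> f x \<sqsubseteq>\<^bsub>M\<^esub> f y \<longleftrightarrow> x \<sqsubseteq>\<^bsub>L\<^esub> y"
  shows "f \<in> lattice_hom L M"
proof -
  interpret L: lattice L by fact
  interpret M: lattice M by fact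
  have fc: "f x \<in> carrier M" if "x \<in> carrier L" for x using f that by (auto dest: bij_betwE)
  have onto: "\<exists>x\<in>carrier L. w = f x" if "w \<in> carrier M" for w
    using f that by (auto simp: bij_betw_def)
  have "f (x \<squnion>\<^bsub>L\<^esub> y) = f x \<squnion>\<^bsub>M\<^esub> f y" if "x \<in> carrier L" "y \<in> carrier L" for x y
  proof (rule M.join_eqI[symmetric])
    fix w assume "w \<in> carrier M" "f x \<sqsubseteq>\<^bsub>M\<^esub> w" "f y \<sqsubseteq>\<^bsub>M\<^esub> w"
    with onto[of w] show "f (x \<squnion>\<^bsub>L\<^esub> y) \<sqsubseteq>\<^bsub>M\<^esub> w"
      using that by (auto simp: le intro: L.join_le)
  qed (use that in \<open>auto simp: fc le L.join_left L.join_right\<close>)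
  moreover have "f (x \<sqinter>\<^bsub>L\<^esub> y) = f x \<sqinter>\<^bsub>M\<^esub> f y" if "x \<in> carrier L" "y \<in> carrier L" for x y
  proof (rule M.meet_eqI[symmetric])
    fix w assume "w \<in> carrier M" "w \<sqsubseteq>\<^bsub>M\<^esub> f x" "w \<sqsubseteq>\<^bsub>M\<^esub> f y"
    with onto[of w] show "w \<sqsubseteq>\<^bsub>M\<^esub> f (x \<sqinter>\<^bsub>L\<^esub> y)"
      using that by (auto simp: le intro: L.meet_le)
  qed (use that in \<open>auto simp: fc le L.meet_left L.meet_right\<close>)
  ultimately show ?thesis
    using L M fc by (auto simp: lattice_hom_def join_pres_def meet_pres_def)
qed

lemma lattice_congruence_dual: "lattice_congruence (inv_gorder L) \<Theta> \<longleftrightarrow> lattice_congruence L \<Theta>"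
  by (auto simp: lattice_congruence_def)

section \<open>Calculus of a single congruence\<close>

locale lattice_cong = lattice L for L (structure) +
  fixes \<Theta>
  assumes cong: "lattice_congruence L \<Theta>"
begin

lemma cong_equiv: "equiv (carrier L) \<Theta>"
  using cong by (simp add: lattice_congruence_def)

lemma cong_carrier: "(x, y) \<in> \<Theta> \<Longrightarrow> x \<in> carrier L \<and> y \<in> carrier L"
  using cong_equiv by (metis equiv_class_eq_iff)

lemma cong_refl: "x \<in> carrier L \<Longrightarrow> (x, x) \<in> \<Theta>"
  using cong_equiv by (meson equiv_def refl_onD)

lemma cong_sym: "(x, y) \<in> \<Theta> \<Longrightarrow> (y, x) \<in> \<Theta>"
  using cong_equiv by (meson equiv_def symE)

lemma cong_trans: "\<lbrakk>(x, y) \<in> \<Theta>; (y, z) \<in> \<Theta>\<rbrakk> \<Longrightarrow> (x, z) \<in> \<Theta>"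
  using cong_equiv by (meson equiv_def transE)

lemma cong_join: "\<lbrakk>(x, y) \<in> \<Theta>; (u, v) \<in> \<Theta>\<rbrakk> \<Longrightarrow> (x \<squnion> u, y \<squnion> v) \<in> \<Theta>"
  using cong by (simp add: lattice_congruence_def)

lemma cong_meet: "\<lbrakk>(x, y) \<in> \<Theta>; (u, v) \<in> \<Theta>\<rbrakk> \<Longrightarrow> (x \<sqinter> u, y \<sqinter> v) \<in> \<Theta>"
  using cong by (simp add: lattice_congruence_def)

lemma cong_join_right: "\<lbrakk>(x, y) \<in> \<Theta>; u \<in> carrier L\<rbrakk> \<Longrightarrow> (x \<squnion> u, y \<squnion> u) \<in> \<Theta>"
  by (simp add: cong_join cong_refl)

lemma cong_meet_right: "\<lbrakk>(x, y) \<in> \<Theta>; u \<in> carrier L\<rbrakk> \<Longrightarrow> (x \<sqinter> u, y \<sqinter> u) \<in> \<Theta>"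
  by (simp add: cong_meet cong_refl)

text \<open>Both the meet and the join of a congruent pair are congruent to its members. Collapsed
  pairs can thus be replaced by comparable ones.\<close>

lemma cong_meet_join: "(x, y) \<in> \<Theta> \<Longrightarrow> (x \<sqinter> y, x \<squnion> y) \<in> \<Theta>"
  by (metis cong_carrier cong_join_right cong_meet_right cong_sym cong_trans join_idem meet_idem)

text \<open>Joining the pair with \<open>a\<close> fixes \<open>y\<close> and sends \<open>x\<close>
  to \<open>a\<close>.\<close>

lemma cong_upper:
  assumes "(x, y) \<in> \<Theta>" "x \<sqsubseteq> a" "a \<sqsubseteq> y" "a \<in> carrier L"
  shows "(a, y) \<in> \<Theta>"
  using cong_join_right[OF assms(1,4)] assms cong_carrier[OF assms(1)]
  by (simp add: join_absorb join_absorb2)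

lemma cong_convex:
  assumes "(x, y) \<in> \<Theta>" "x \<sqsubseteq> a" "a \<sqsubseteq> y" "x \<sqsubseteq> b" "b \<sqsubseteq> y" "a \<in> carrier L" "b \<in> carrier L"
  shows "(a, b) \<in> \<Theta>"
  using cong_upper assms cong_sym cong_trans by blast

end

lemma lattice_congI: "\<lbrakk>lattice L; lattice_congruence L \<Theta>\<rbrakk> \<Longrightarrow> lattice_cong L \<Theta>"
  by (simp add: lattice_cong_def lattice_cong_axioms_def)

text \<open>Translations in one argument suffice: pass from \<open>x \<squnion> u\<close> to
  \<open>y \<squnion> u\<close> and then, by commutativity, to \<open>y \<squnion> v\<close>;
  likewise for meets.\<close>

lemma lattice_congruenceI:
  fixes L (structure)
  assumes "lattice L" "equiv (carrier L) \<Theta>"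
    and j: "\<And>x y w. \<lbrakk>(x, y) \<in> \<Theta>; w \<in> carrier L\<rbrakk> \<Longrightarrow> (x \<squnion> w, y \<squnion> w) \<in> \<Theta>"
    and m: "\<And>x y w. \<lbrakk>(x, y) \<in> \<Theta>; w \<in> carrier L\<rbrakk> \<Longrightarrow> (x \<sqinter> w, y \<sqinter> w) \<in> \<Theta>"
  shows "lattice_congruence L \<Theta>"
  unfolding lattice_congruence_def
proof (intro conjI allI impI)
  fix x y u v assume xy: "(x, y) \<in> \<Theta>" and uv: "(u, v) \<in> \<Theta>"
  have c: "y \<in> carrier L" "u \<in> carrier L"
    using xy uv \<open>equiv (carrier L) \<Theta>\<close> by (meson equiv_class_eq_iff)+
  have tr: "\<And>a b c. \<lbrakk>(a, b) \<in> \<Theta>; (b, c) \<in> \<Theta>\<rbrakk> \<Longrightarrow> (a, c) \<in> \<Theta>"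
    using \<open>equiv (carrier L) \<Theta>\<close> by (meson equiv_def transE)
  show "(x \<squnion> u, y \<squnion> v) \<in> \<Theta>"
    using tr[OF j[OF xy c(2)]] j[OF uv c(1)] by (simp add: join_comm[of L y])
  show "(x \<sqinter> u, y \<sqinter> v) \<in> \<Theta>"
    using tr[OF m[OF xy c(2)]] m[OF uv c(1)] by (simp add: meet_comm[of L y])
qed fact

section \<open>Meet-prime congruences\<close>

text \<open>These are the meet-prime members of the congruence lattice, given through a pair that
  they separate maximally. In this form meet-primeness is immediate, and the full relation is
  excluded because it separates nothing.\<close>

definition meet_prime_congruences :: "('a, 'm) gorder_scheme \<Rightarrow> 'a rel set" where
  "meet_prime_congruences L = {\<phi>. lattice_congruence L \<phi> \<and>
     (\<exists>u\<in>carrier L. \<exists>v\<in>carrier L. (u, v) \<notin> \<phi> \<and>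
        (\<forall>\<Theta>. lattice_congruence L \<Theta> \<longrightarrow> (u, v) \<notin> \<Theta> \<longrightarrow> \<Theta> \<subseteq> \<phi>))}"

text \<open>The join of all congruences omitting \<open>(u, v)\<close> is the transitive closure of
  their union. In a longer interval such a join could reach \<open>(u, v)\<close> through
  intermediate points; a covering pair leaves no room for that.\<close>

lemma (in lattice) meet_prime_avoiding_cover:
  assumes u: "u \<in> carrier L" and v: "v \<in> carrier L" and uv: "u \<sqsubseteq> v" "u \<noteq> v"
    and cover: "\<forall>w\<in>carrier L. u \<sqsubseteq> w \<longrightarrow> w \<sqsubseteq> v \<longrightarrow> w = u \<or> w = v"
  shows "\<exists>\<phi>\<in>meet_prime_congruences L. (u, v) \<notin> \<phi> \<and>
    (\<forall>\<Theta>. lattice_congruence L \<Theta> \<longrightarrow> (u, v) \<notin> \<Theta> \<longrightarrow> \<Theta> \<subseteq> \<phi>)"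
proof -
  define U where "U = \<Union>{\<Theta>. lattice_congruence L \<Theta> \<and> (u, v) \<notin> \<Theta>}"
  define \<phi> where "\<phi> = U\<^sup>+"
  have UD: "\<exists>\<Theta>. lattice_cong L \<Theta> \<and> (u, v) \<notin> \<Theta> \<and> (x, y) \<in> \<Theta> \<and> \<Theta> \<subseteq> U" if "(x, y) \<in> U" for x y
    using that unfolding U_def by (blast intro: lattice_congI lattice_axioms)
  \<comment> \<open>The identity congruence omits \<open>(u, v)\<close>, which makes
    \<open>U\<close> reflexive on the carrier.\<close>
  have "lattice_congruence L (Id_on (carrier L))"
    by (auto simp: lattice_congruence_def equiv_def refl_on_def sym_def trans_def)
  with uv have Id: "Id_on (carrier L) \<subseteq> U" unfolding U_def by auto
  have U_carrier: "x \<in> carrier L \<and> y \<in> carrier L" if "(x, y) \<in> U" for x y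
    using UD[OF that] by (auto dest: lattice_cong.cong_carrier)
  have U_sym: "(y, x) \<in> U" if "(x, y) \<in> U" for x y
    using UD[OF that] by (auto dest: lattice_cong.cong_sym)
  have Uj: "(x \<squnion> w, y \<squnion> w) \<in> U" and Um: "(x \<sqinter> w, y \<sqinter> w) \<in> U"
    if "(x, y) \<in> U" "w \<in> carrier L" for x y w
    using UD[OF that(1)] lattice_cong.cong_join_right[OF _ _ that(2)]
      lattice_cong.cong_meet_right[OF _ _ that(2)] by (meson subsetD)+
  have \<phi>_carrier: "\<phi> \<subseteq> carrier L \<times> carrier L"
    unfolding \<phi>_def by (rule trancl_subset_Sigma) (use U_carrier in auto)
  have eqv: "equiv (carrier L) \<phi>"
  proof (rule equivI)
    show "refl_on (carrier L) \<phi>"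
      using Id \<phi>_carrier by (auto simp: refl_on_def \<phi>_def)
    show "sym \<phi>" unfolding \<phi>_def by (rule sym_trancl) (auto intro: symI U_sym)
    show "trans \<phi>" unfolding \<phi>_def by simp
  qed (use \<phi>_carrier in simp)
  have cong: "lattice_congruence L \<phi>"
  proof (rule lattice_congruenceI[OF lattice_axioms eqv])
    fix x y w assume "(x, y) \<in> \<phi>" and w: "w \<in> carrier L"
    then have "(x, y) \<in> U\<^sup>+" by (simp add: \<phi>_def)
    then have "(x \<squnion> w, y \<squnion> w) \<in> \<phi> \<and> (x \<sqinter> w, y \<sqinter> w) \<in> \<phi>"
      unfolding \<phi>_def
    proof (induction rule: trancl_induct)
      case (base y)
      then show ?case using Uj Um w by blast
    next
      case (step y z)
      then show ?case using Uj[OF step(2) w] Um[OF step(2) w] by (meson trancl.trancl_into_trancl)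
    qed
    then show "(x \<squnion> w, y \<squnion> w) \<in> \<phi>" "(x \<sqinter> w, y \<sqinter> w) \<in> \<phi>" by blast+
  qed
  text \<open>The map \<open>w \<mapsto> (w \<squnion> u) \<sqinter> v\<close> sends any chain of steps in \<open>U\<close> into \<open>{u, v}\<close>, and no
    single step can lead from \<open>u\<close> to \<open>v\<close>.\<close>
  have chain_step: "(z \<squnion> u) \<sqinter> v = u" if yz: "(y, z) \<in> U" and y: "(y \<squnion> u) \<sqinter> v = u" for y z
  proof -
    obtain \<Theta> where \<Theta>: "lattice_cong L \<Theta>" "(u, v) \<notin> \<Theta>" "(y, z) \<in> \<Theta>"
      using UD[OF yz] by blast
    interpret lattice_cong L \<Theta> by fact
    have z: "z \<in> carrier L" using U_carrier[OF yz] by simp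
    have "(u, (z \<squnion> u) \<sqinter> v) \<in> \<Theta>"
      using cong_meet_right[OF cong_join_right[OF \<Theta>(3) u] v] y by simp
    moreover have "(z \<squnion> u) \<sqinter> v = u \<or> (z \<squnion> u) \<sqinter> v = v"
      using z u v uv by (intro cover[rule_format]) (auto intro: meet_le join_right meet_right)
    ultimately show ?thesis using \<Theta>(2) by auto
  qed
  have avoid: "(u, v) \<notin> \<phi>"
  proof
    have "(w \<squnion> u) \<sqinter> v = u" if "(u, w) \<in> U\<^sup>+" for w
      using that
    proof (induction rule: trancl_induct)
      case (base y)
      then show ?case using chain_step u v uv by (simp add: join_idem meet_absorb)
    next
      case (step y z)
      from chain_step[OF step.hyps(2) step.IH] show ?case .
    qed
    moreover assume "(u, v) \<in> \<phi>"
    ultimately have "(v \<squnion> u) \<sqinter> v = u" by (simp add: \<phi>_def)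
    then show False using u v uv by (simp add: join_absorb2 meet_idem)
  qed
  have max: "\<Theta> \<subseteq> \<phi>" if "lattice_congruence L \<Theta>" "(u, v) \<notin> \<Theta>" for \<Theta>
    using that unfolding \<phi>_def U_def by auto
  have "\<phi> \<in> meet_prime_congruences L"
    unfolding meet_prime_congruences_def using cong avoid max u v by blast
  then show ?thesis using avoid max by blast
qed

text \<open>If some \<open>w\<close> lies strictly between the ends, transitivity prevents both
  halves from being collapsed, so the search continues in a strictly smaller interval.\<close>

lemma (in lattice_cong) cover_not_in_cong:
  assumes fin: "finite (carrier L)" and xy: "x \<in> carrier L" "y \<in> carrier L" "x \<sqsubseteq> y" "(x, y) \<notin> \<Theta>"
  shows "\<exists>u v. u \<in> carrier L \<and> v \<in> carrier L \<and> x \<sqsubseteq> u \<and> u \<sqsubseteq> v \<and> v \<sqsubseteq> y \<and> (u, v) \<notin> \<Theta> \<and>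
    (\<forall>w\<in>carrier L. u \<sqsubseteq> w \<longrightarrow> w \<sqsubseteq> v \<longrightarrow> w = u \<or> w = v)"
proof -
  define I where "I a b = {w \<in> carrier L. a \<sqsubseteq> w \<and> w \<sqsubseteq> b}" for a b
  show ?thesis
    using xy
  proof (induction "card (I x y)" arbitrary: x y rule: less_induct)
    case less
    show ?case
    proof (cases "\<forall>w\<in>carrier L. x \<sqsubseteq> w \<longrightarrow> w \<sqsubseteq> y \<longrightarrow> w = x \<or> w = y")
      case True
      then show ?thesis using less.prems by blast
    next
      case False
      then obtain w where w: "w \<in> carrier L" "x \<sqsubseteq> w" "w \<sqsubseteq> y" "w \<noteq> x" "w \<noteq> y" by blast
      have fin': "finite (I a b)" for a b using fin by (simp add: I_def)
      have "I x w \<subset> I x y" "I w y \<subset> I x y"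
        using less.prems w by (auto simp: I_def psubset_eq set_eq_iff intro: le_trans)
      then have lt: "card (I x w) < card (I x y)" "card (I w y) < card (I x y)"
        by (simp_all add: psubset_card_mono fin')
      have "(x, w) \<notin> \<Theta> \<or> (w, y) \<notin> \<Theta>"
        using less.prems(4) cong_trans by blast
      then show ?thesis
      proof
        assume "(x, w) \<notin> \<Theta>"
        from less.hyps[OF lt(1) less.prems(1) w(1,2) this] show ?thesis
          using w less.prems by (meson le_trans)
      next
        assume "(w, y) \<notin> \<Theta>"
        from less.hyps[OF lt(2) w(1) less.prems(2) w(3) this] show ?thesis
          using w less.prems by (meson le_trans)
      qed
    qed
  qed
qed

text \<open>Between the meet and the join of \<open>x\<close> and \<open>y\<close> lies a covering
  pair outside \<open>\<Theta>\<close>, and the largest congruence omitting it contains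
  \<open>\<Theta>\<close>. It cannot contain \<open>(x, y)\<close>, since by convexity it would then
  contain the covering pair.\<close>

lemma (in lattice_cong) meet_prime_congruence_separates:
  assumes fin: "finite (carrier L)" and xy: "x \<in> carrier L" "y \<in> carrier L" "(x, y) \<notin> \<Theta>"
  obtains \<phi> where "\<phi> \<in> meet_prime_congruences L" "\<Theta> \<subseteq> \<phi>" "(x, y) \<notin> \<phi>"
proof -
  have "(x \<sqinter> y, x \<squnion> y) \<notin> \<Theta>"
    using cong_convex[of "x \<sqinter> y" "x \<squnion> y" x y] xy
    by (auto simp: meet_left meet_right join_left join_right)
  then obtain u v where uv: "u \<in> carrier L" "v \<in> carrier L" "x \<sqinter> y \<sqsubseteq> u" "u \<sqsubseteq> v" "v \<sqsubseteq> x \<squnion> y" "(u, v) \<notin> \<Theta>"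
    and cover: "\<forall>w\<in>carrier L. u \<sqsubseteq> w \<longrightarrow> w \<sqsubseteq> v \<longrightarrow> w = u \<or> w = v"
    using cover_not_in_cong[OF fin meet_closed[OF xy(1,2)] join_closed[OF xy(1,2)] meet_le_join[OF xy(1,2)]]
    by blast
  have "u \<noteq> v" using uv cong_refl by blast
  from meet_prime_avoiding_cover[OF uv(1,2,4) this cover]
  obtain \<phi> where \<phi>: "\<phi> \<in> meet_prime_congruences L" "(u, v) \<notin> \<phi>"
    and max: "\<forall>\<Theta>. lattice_congruence L \<Theta> \<longrightarrow> (u, v) \<notin> \<Theta> \<longrightarrow> \<Theta> \<subseteq> \<phi>"
    by (elim bexE conjE)
  have \<phi>c: "lattice_cong L \<phi>"
    using \<phi>(1) by (intro lattice_congI[OF lattice_axioms]) (simp add: meet_prime_congruences_def)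
  have "(x, y) \<notin> \<phi>"
  proof
    assume "(x, y) \<in> \<phi>"
    from lattice_cong.cong_convex[OF \<phi>c lattice_cong.cong_meet_join[OF \<phi>c this], of u v]
    have "(u, v) \<in> \<phi>"
      using le_trans[OF uv(3,4)] le_trans[OF uv(4,5)] uv xy by simp
    then show False using \<phi>(2) by simp
  qed
  then show thesis by (rule that[OF \<phi>(1) max[rule_format, OF cong uv(6)]])
qed

text \<open>This is meet-primeness: \<open>\<phi>\<close> omits its pair \<open>(u, v)\<close>,
  hence so does the intersection, hence some member of \<open>T\<close> does, and that member lies
  below \<open>\<phi>\<close> by maximality. The factor \<open>carrier L \<times> carrier L\<close>
  makes the empty intersection the full congruence.\<close>

lemma meet_prime_congruence_Inter:
  assumes "\<phi> \<in> meet_prime_congruences L" "\<And>\<psi>. \<psi> \<in> T \<Longrightarrow> lattice_congruence L \<psi>"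
    and "carrier L \<times> carrier L \<inter> \<Inter>T \<subseteq> \<phi>"
  obtains \<psi> where "\<psi> \<in> T" "\<psi> \<subseteq> \<phi>"
proof -
  obtain u v where uv: "u \<in> carrier L" "v \<in> carrier L" "(u, v) \<notin> \<phi>"
    and max: "\<forall>\<Theta>. lattice_congruence L \<Theta> \<longrightarrow> (u, v) \<notin> \<Theta> \<longrightarrow> \<Theta> \<subseteq> \<phi>"
    using assms(1) unfolding meet_prime_congruences_def by (elim CollectE bexE conjE)
  from uv assms(3) obtain \<psi> where "\<psi> \<in> T" "(u, v) \<notin> \<psi>" by blast
  then show thesis using that[of \<psi>] max[rule_format, OF assms(2)] by blast
qed

section \<open>Pruned products\<close>

text \<open>Among the comparabilities of the direct product, those are deleted which change a coordinate
  \<open>p\<close> while keeping some coordinate \<open>q\<close> with \<open>(p, q) \<in> R\<close> fixed at \<open>v q\<close>. This forces every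
  congruence that collapses something at \<open>p\<close> to collapse something at \<open>q\<close>.\<close>

definition pruned :: "'i set \<Rightarrow> 'i rel \<Rightarrow> ('i \<Rightarrow> 'b gorder) \<Rightarrow> ('i \<Rightarrow> 'b) \<Rightarrow> ('i \<Rightarrow> 'b) gorder" where
  "pruned I R A v = \<lparr>carrier = (\<Pi>\<^sub>E i\<in>I. carrier (A i)), eq = (=),
     le = (\<lambda>x y. (\<forall>i\<in>I. x i \<sqsubseteq>\<^bsub>A i\<^esub> y i) \<and> (\<forall>(p, q)\<in>R. x p \<noteq> y p \<longrightarrow> \<not> (x q = v q \<and> y q = v q)))\<rparr>"

text \<open>The pruning condition is symmetric in the two elements, so reversing the factors
  reverses the whole order.\<close>

lemma pruned_dual: "pruned I R (\<lambda>i. inv_gorder (A i)) v = inv_gorder (pruned I R A v)"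
  unfolding pruned_def by (auto simp: fun_eq_iff)

text \<open>The last four assumptions make \<open>v i\<close> both an atom and a coatom of
  \<open>A i\<close>: it can move only to a bound. Well-foundedness of \<open>R\<close> allows joins
  to be computed by recursion, where the value at \<open>q\<close> depends on the coordinates
  \<open>p\<close> with \<open>(p, q) \<in> R\<close>.\<close>

locale pruned_product =
  fixes I :: "'i set" and R :: "'i rel" and A :: "'i \<Rightarrow> 'b gorder" and v bt tp :: "'i \<Rightarrow> 'b"
  assumes A_lattice: "i \<in> I \<Longrightarrow> lattice (A i)"
    and R_sub: "R \<subseteq> I \<times> I" and wf_R: "wf R"
    and bt_closed: "i \<in> I \<Longrightarrow> bt i \<in> carrier (A i)"
    and tp_closed: "i \<in> I \<Longrightarrow> tp i \<in> carrier (A i)"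
    and v_closed: "i \<in> I \<Longrightarrow> v i \<in> carrier (A i)"
    and bt_le: "i \<in> I \<Longrightarrow> s \<in> carrier (A i) \<Longrightarrow> bt i \<sqsubseteq>\<^bsub>A i\<^esub> s"
    and le_tp: "i \<in> I \<Longrightarrow> s \<in> carrier (A i) \<Longrightarrow> s \<sqsubseteq>\<^bsub>A i\<^esub> tp i"
    and v_neq_bt: "i \<in> I \<Longrightarrow> v i \<noteq> bt i"
    and v_neq_tp: "i \<in> I \<Longrightarrow> v i \<noteq> tp i"
    and le_v: "i \<in> I \<Longrightarrow> s \<in> carrier (A i) \<Longrightarrow> s \<sqsubseteq>\<^bsub>A i\<^esub> v i \<Longrightarrow> s = v i \<or> s = bt i"
    and v_le: "i \<in> I \<Longrightarrow> s \<in> carrier (A i) \<Longrightarrow> v i \<sqsubseteq>\<^bsub>A i\<^esub> s \<Longrightarrow> s = v i \<or> s = tp i"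
begin

abbreviation P :: "('i \<Rightarrow> 'b) gorder" where "P \<equiv> pruned I R A v"

text \<open>The assumptions are self-dual with \<open>bt\<close> and \<open>tp\<close> exchanged, so
  each result on joins yields its counterpart for meets.\<close>

lemma dual: "pruned_product I R (\<lambda>i. inv_gorder (A i)) v tp bt"
  unfolding pruned_product_def
  using A_lattice R_sub wf_R bt_closed tp_closed v_closed bt_le le_tp v_neq_bt v_neq_tp le_v v_le
  by (simp add: lattice_dual_iff)

lemma A_refl: "\<lbrakk>i \<in> I; s \<in> carrier (A i)\<rbrakk> \<Longrightarrow> s \<sqsubseteq>\<^bsub>A i\<^esub> s"
proof -
  assume i: "i \<in> I" and s: "s \<in> carrier (A i)"
  interpret lattice "A i" by (rule A_lattice[OF i])
  show ?thesis by (rule le_refl[OF s])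
qed

lemma A_antisym:
  "\<lbrakk>i \<in> I; s \<in> carrier (A i); t \<in> carrier (A i); s \<sqsubseteq>\<^bsub>A i\<^esub> t; t \<sqsubseteq>\<^bsub>A i\<^esub> s\<rbrakk> \<Longrightarrow> s = t"
proof -
  assume i: "i \<in> I" and st: "s \<sqsubseteq>\<^bsub>A i\<^esub> t" "t \<sqsubseteq>\<^bsub>A i\<^esub> s" "s \<in> carrier (A i)" "t \<in> carrier (A i)"
  interpret lattice "A i" by (rule A_lattice[OF i])
  show ?thesis by (rule le_antisym[OF st])
qed

lemma A_trans:
  "\<lbrakk>i \<in> I; s \<in> carrier (A i); t \<in> carrier (A i); w \<in> carrier (A i); s \<sqsubseteq>\<^bsub>A i\<^esub> t; t \<sqsubseteq>\<^bsub>A i\<^esub> w\<rbrakk> \<Longrightarrow> s \<sqsubseteq>\<^bsub>A i\<^esub> w"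
proof -
  assume i: "i \<in> I" and st: "s \<sqsubseteq>\<^bsub>A i\<^esub> t" "t \<sqsubseteq>\<^bsub>A i\<^esub> w" "s \<in> carrier (A i)" "t \<in> carrier (A i)" "w \<in> carrier (A i)"
  interpret lattice "A i" by (rule A_lattice[OF i])
  show ?thesis by (rule le_trans[OF st])
qed

lemma A_join:
  assumes i: "i \<in> I" and st: "s \<in> carrier (A i)" "t \<in> carrier (A i)"
  shows "s \<squnion>\<^bsub>A i\<^esub> t \<in> carrier (A i)" "s \<sqsubseteq>\<^bsub>A i\<^esub> s \<squnion>\<^bsub>A i\<^esub> t" "t \<sqsubseteq>\<^bsub>A i\<^esub> s \<squnion>\<^bsub>A i\<^esub> t"
    "\<And>w. \<lbrakk>w \<in> carrier (A i); s \<sqsubseteq>\<^bsub>A i\<^esub> w; t \<sqsubseteq>\<^bsub>A i\<^esub> w\<rbrakk> \<Longrightarrow> s \<squnion>\<^bsub>A i\<^esub> t \<sqsubseteq>\<^bsub>A i\<^esub> w"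
proof -
  interpret lattice "A i" by (rule A_lattice[OF i])
  show "s \<squnion>\<^bsub>A i\<^esub> t \<in> carrier (A i)" "s \<sqsubseteq>\<^bsub>A i\<^esub> s \<squnion>\<^bsub>A i\<^esub> t" "t \<sqsubseteq>\<^bsub>A i\<^esub> s \<squnion>\<^bsub>A i\<^esub> t"
    by (rule join_closed[OF st] join_left[OF st] join_right[OF st])+
  show "s \<squnion>\<^bsub>A i\<^esub> t \<sqsubseteq>\<^bsub>A i\<^esub> w" if "w \<in> carrier (A i)" "s \<sqsubseteq>\<^bsub>A i\<^esub> w" "t \<sqsubseteq>\<^bsub>A i\<^esub> w" for w
    by (rule join_le[OF that(2,3) st that(1)])
qed

lemma bt_neq_tp: "i \<in> I \<Longrightarrow> bt i \<noteq> tp i"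
  using A_antisym[of i "v i" "bt i"] bt_closed v_closed bt_le le_tp v_neq_bt by metis

lemmas bt_neq_v = v_neq_bt[symmetric] and tp_neq_v = v_neq_tp[symmetric]

lemma le_bt: "\<lbrakk>i \<in> I; s \<in> carrier (A i); s \<sqsubseteq>\<^bsub>A i\<^esub> bt i\<rbrakk> \<Longrightarrow> s = bt i"
  using A_antisym bt_closed bt_le by metis

lemma tp_le: "\<lbrakk>i \<in> I; s \<in> carrier (A i); tp i \<sqsubseteq>\<^bsub>A i\<^esub> s\<rbrakk> \<Longrightarrow> s = tp i"
  using A_antisym tp_closed le_tp by metis

text \<open>Both arguments lie below the atom \<open>v i\<close>; if neither were
  \<open>v i\<close>, both would be the bottom, and so would their join.\<close>

lemma join_eq_v:
  assumes "i \<in> I" "s \<in> carrier (A i)" "t \<in> carrier (A i)" "s \<squnion>\<^bsub>A i\<^esub> t = v i"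
  shows "s = v i \<or> t = v i"
proof (rule ccontr)
  assume "\<not> (s = v i \<or> t = v i)"
  with assms A_join(2,3)[OF assms(1-3)] have "s = bt i" "t = bt i" using le_v by metis+
  then have "s \<squnion>\<^bsub>A i\<^esub> t \<sqsubseteq>\<^bsub>A i\<^esub> bt i" using assms A_join(4) A_refl bt_closed by metis
  then show False using assms le_bt v_closed v_neq_bt by metis
qed

lemma R_I: "(p, q) \<in> R \<Longrightarrow> p \<in> I \<and> q \<in> I"
  using R_sub by auto

lemma R_irrefl: "(p, p) \<notin> R"
  using wf_R by simp

lemma P_carrier: "x \<in> carrier P \<longleftrightarrow> x \<in> (\<Pi>\<^sub>E i\<in>I. carrier (A i))"
  by (simp add: pruned_def)

lemma P_coord: "\<lbrakk>x \<in> carrier P; i \<in> I\<rbrakk> \<Longrightarrow> x i \<in> carrier (A i)"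
  by (auto simp: P_carrier)

lemma P_eqI: "\<lbrakk>x \<in> carrier P; y \<in> carrier P; \<And>i. i \<in> I \<Longrightarrow> x i = y i\<rbrakk> \<Longrightarrow> x = y"
  by (auto simp: P_carrier intro: PiE_ext)

lemma P_le: "x \<sqsubseteq>\<^bsub>P\<^esub> y \<longleftrightarrow> (\<forall>i\<in>I. x i \<sqsubseteq>\<^bsub>A i\<^esub> y i) \<and>
    (\<forall>p q. (p, q) \<in> R \<longrightarrow> x q = v q \<longrightarrow> y q = v q \<longrightarrow> x p = y p)"
  by (auto simp: pruned_def)

lemma P_partial_order: "partial_order P"
proof (rule partial_orderI_eq)
  show "eq P = (=)" by (simp add: pruned_def)
  show "x \<sqsubseteq>\<^bsub>P\<^esub> x" if "x \<in> carrier P" for x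
    using that by (simp add: P_le A_refl P_coord)
  show "x = y" if "x \<in> carrier P" "y \<in> carrier P" "x \<sqsubseteq>\<^bsub>P\<^esub> y" "y \<sqsubseteq>\<^bsub>P\<^esub> x" for x y
    using that by (intro P_eqI) (auto simp: P_le intro: A_antisym P_coord)
  fix x y z assume xyz: "x \<in> carrier P" "y \<in> carrier P" "z \<in> carrier P" "x \<sqsubseteq>\<^bsub>P\<^esub> y" "y \<sqsubseteq>\<^bsub>P\<^esub> z"
  have le: "x i \<sqsubseteq>\<^bsub>A i\<^esub> y i" "y i \<sqsubseteq>\<^bsub>A i\<^esub> z i" if "i \<in> I" for i
    using xyz that by (auto simp: P_le)
  have "x p = z p" if pq: "(p, q) \<in> R" and v: "x q = v q" "z q = v q" for p q
  proof -
    \<comment> \<open>The middle element is squeezed between two copies of \<open>v q\<close>, so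
      both pruning conditions apply at \<open>q\<close>.\<close>
    have "y q = v q"
      using le[of q] v R_I[OF pq] A_antisym[of q "y q" "v q"] P_coord[OF xyz(2)] v_closed by simp
    then show ?thesis using xyz(4,5) pq v by (simp add: P_le)
  qed
  then show "x \<sqsubseteq>\<^bsub>P\<^esub> z"
    using le A_trans P_coord[OF xyz(1)] P_coord[OF xyz(2)] P_coord[OF xyz(3)] unfolding P_le by blast
qed

text \<open>The componentwise join fails to be an upper bound where it equals \<open>v q\<close>
  while an argument with value \<open>v q\<close> at \<open>q\<close> has been changed at some
  \<open>p\<close> with \<open>(p, q) \<in> R\<close>. There the value is raised to
  \<open>tp q\<close>, the only element above \<open>v q\<close>. A raise at \<open>p\<close> can
  trigger one at \<open>q\<close>, hence the recursion along \<open>R\<close>.\<close>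

definition pjoin :: "('i \<Rightarrow> 'b) \<Rightarrow> ('i \<Rightarrow> 'b) \<Rightarrow> 'i \<Rightarrow> 'b" where
  "pjoin x y = restrict (wfrec R (\<lambda>z q.
     if x q \<squnion>\<^bsub>A q\<^esub> y q = v q \<and> (\<exists>p. (p, q) \<in> R \<and> (x q = v q \<and> z p \<noteq> x p \<or> y q = v q \<and> z p \<noteq> y p))
     then tp q else x q \<squnion>\<^bsub>A q\<^esub> y q)) I"

lemma pjoin_eq:
  assumes "q \<in> I"
  shows "pjoin x y q = (if x q \<squnion>\<^bsub>A q\<^esub> y q = v q \<and>
      (\<exists>p. (p, q) \<in> R \<and> (x q = v q \<and> pjoin x y p \<noteq> x p \<or> y q = v q \<and> pjoin x y p \<noteq> y p))
    then tp q else x q \<squnion>\<^bsub>A q\<^esub> y q)"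
proof -
  define H where "H = (\<lambda>z q.
     if x q \<squnion>\<^bsub>A q\<^esub> y q = v q \<and> (\<exists>p. (p, q) \<in> R \<and> (x q = v q \<and> z p \<noteq> x p \<or> y q = v q \<and> z p \<noteq> y p))
     then tp q else x q \<squnion>\<^bsub>A q\<^esub> y q)"
  have pj: "pjoin x y p = wfrec R H p" if "p \<in> I" for p
    using that by (simp add: pjoin_def H_def)
  have "pjoin x y q = H (cut (wfrec R H) R q) q"
    unfolding pj[OF assms] by (rule wfrec[OF wf_R])
  also have "\<dots> = H (pjoin x y) q"
  proof -
    \<comment> \<open>The body inspects only predecessors of \<open>q\<close>, all of which lie in
      \<open>I\<close>; neither the cut nor the restriction is visible there.\<close>
    have "cut (wfrec R H) R q p = pjoin x y p" if "(p, q) \<in> R" for p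
      using that pj[of p] R_I by (simp add: cut_apply)
    then have "(\<exists>p. (p, q) \<in> R \<and> Q p (cut (wfrec R H) R q p)) \<longleftrightarrow> (\<exists>p. (p, q) \<in> R \<and> Q p (pjoin x y p))"
      for Q by metis
    from this[of "\<lambda>p z. x q = v q \<and> z \<noteq> x p \<or> y q = v q \<and> z \<noteq> y p"]
    show ?thesis by (simp only: H_def)
  qed
  finally show ?thesis by (simp add: H_def)
qed

lemma pjoin_cases:
  assumes "q \<in> I"
  obtains
    (raised) p where "pjoin x y q = tp q" "x q \<squnion>\<^bsub>A q\<^esub> y q = v q" "(p, q) \<in> R"
      "x q = v q \<and> pjoin x y p \<noteq> x p \<or> y q = v q \<and> pjoin x y p \<noteq> y p"
  | (plain) "pjoin x y q = x q \<squnion>\<^bsub>A q\<^esub> y q"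
      "\<And>p. \<lbrakk>(p, q) \<in> R; x q \<squnion>\<^bsub>A q\<^esub> y q = v q\<rbrakk> \<Longrightarrow>
         (x q = v q \<longrightarrow> pjoin x y p = x p) \<and> (y q = v q \<longrightarrow> pjoin x y p = y p)"
proof -
  let ?c = "x q \<squnion>\<^bsub>A q\<^esub> y q = v q \<and>
      (\<exists>p. (p, q) \<in> R \<and> (x q = v q \<and> pjoin x y p \<noteq> x p \<or> y q = v q \<and> pjoin x y p \<noteq> y p))"
  show thesis
  proof (cases ?c)
    case True
    have "pjoin x y q = tp q" by (rule trans[OF pjoin_eq[OF assms] if_P[OF True]])
    with True show thesis by (blast intro: raised)
  next
    case False
    have "pjoin x y q = x q \<squnion>\<^bsub>A q\<^esub> y q" by (rule trans[OF pjoin_eq[OF assms] if_not_P[OF False]])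
    with False show thesis by (intro plain) auto
  qed
qed

lemma pjoin_commute: "pjoin x y = pjoin y x"
  unfolding pjoin_def join_comm[of _ "x _"] by (simp add: disj_commute)

context
  fixes x y assumes xy: "x \<in> carrier P" "y \<in> carrier P"
begin

lemma pjoin_closed: "pjoin x y \<in> carrier P"
proof -
  have "pjoin x y q \<in> carrier (A q)" if "q \<in> I" for q
    using pjoin_eq[OF that, of x y] that xy by (auto simp: tp_closed A_join P_coord)
  then show ?thesis by (auto simp: P_carrier pjoin_def)
qed

text \<open>If \<open>x q\<close> and the join at \<open>q\<close> are both \<open>v q\<close>, then
  no raise took place at \<open>q\<close>, which means precisely that \<open>x\<close> is unchanged
  at every \<open>p\<close> with \<open>(p, q) \<in> R\<close>.\<close>

lemma pjoin_upper: "x \<sqsubseteq>\<^bsub>P\<^esub> pjoin x y"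
  unfolding P_le
proof (intro conjI ballI allI impI)
  fix i assume i: "i \<in> I"
  then show "x i \<sqsubseteq>\<^bsub>A i\<^esub> pjoin x y i"
    using xy by (auto simp: pjoin_eq le_tp A_join P_coord)
next
  fix p q assume pq: "(p, q) \<in> R" and q: "x q = v q" "pjoin x y q = v q"
  then have qI: "q \<in> I" using R_I by blast
  then show "x p = pjoin x y p"
  proof (cases rule: pjoin_cases[of q x y])
    case raised
    then show ?thesis using q v_neq_tp[OF qI] by simp
  next
    case plain
    then show ?thesis using plain(2)[OF pq] q by simp
  qed
qed

text \<open>Every raise is forced. If an upper bound \<open>w\<close> kept the value
  \<open>v q\<close>, pruning would make \<open>w p\<close> equal to \<open>x p\<close> or
  \<open>y p\<close> at the changed coordinate \<open>p\<close>; the induction hypothesis at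
  \<open>p\<close> then leaves no change at \<open>p\<close> at all.\<close>

lemma pjoin_least:
  assumes w: "w \<in> carrier P" "x \<sqsubseteq>\<^bsub>P\<^esub> w" "y \<sqsubseteq>\<^bsub>P\<^esub> w"
  shows "pjoin x y \<sqsubseteq>\<^bsub>P\<^esub> w"
proof -
  have le: "x q \<sqsubseteq>\<^bsub>A q\<^esub> w q" "y q \<sqsubseteq>\<^bsub>A q\<^esub> w q" if "q \<in> I" for q
    using that w by (auto simp: P_le)
  have le_pj: "x q \<sqsubseteq>\<^bsub>A q\<^esub> pjoin x y q" "y q \<sqsubseteq>\<^bsub>A q\<^esub> pjoin x y q" if "q \<in> I" for q
    using that xy by (auto simp: pjoin_eq le_tp A_join P_coord)
  note c = P_coord[OF xy(1)] P_coord[OF xy(2)] P_coord[OF w(1)] P_coord[OF pjoin_closed]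
  have coord: "pjoin x y q \<sqsubseteq>\<^bsub>A q\<^esub> w q" if "q \<in> I" for q
    using wf_R that
  proof (induction q rule: wf_induct_rule)
    case (less q)
    note q = \<open>q \<in> I\<close>
    have s: "x q \<squnion>\<^bsub>A q\<^esub> y q \<sqsubseteq>\<^bsub>A q\<^esub> w q"
      using A_join(4) c le q by blast
    from q show ?case
    proof (cases rule: pjoin_cases[of q x y])
      case (raised p)
      have p: "p \<in> I" using R_I[OF raised(3)] by simp
      have IH: "pjoin x y p \<sqsubseteq>\<^bsub>A p\<^esub> w p" by (rule less.IH[OF raised(3) p])
      have "w q \<noteq> v q"
      proof
        assume wq: "w q = v q"
        from raised(4) show False
        proof
          assume "x q = v q \<and> pjoin x y p \<noteq> x p"
          moreover from this have "x p = w p"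
            using w(2) wq raised(3) by (simp add: P_le)
          ultimately show False using A_antisym[OF p c(4)[OF p] c(3)[OF p] IH] le_pj(1)[OF p] by simp
        next
          assume "y q = v q \<and> pjoin x y p \<noteq> y p"
          moreover from this have "y p = w p"
            using w(3) wq raised(3) by (simp add: P_le)
          ultimately show False using A_antisym[OF p c(4)[OF p] c(3)[OF p] IH] le_pj(2)[OF p] by simp
        qed
      qed
      then have "w q = tp q" using s raised(2) v_le[OF q] c(3)[OF q] by auto
      then show ?thesis using raised(1) q tp_closed le_tp by simp
    qed (use s in simp)
  qed
  \<comment> \<open>No raise occurred at \<open>q\<close>, so an argument with value
    \<open>v q\<close> there agrees at \<open>p\<close> with the join, and by pruning also with
    \<open>w\<close>.\<close>
  have "pjoin x y p = w p" if pq: "(p, q) \<in> R" and v: "pjoin x y q = v q" "w q = v q" for p q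
  proof -
    have q: "q \<in> I" using R_I[OF pq] by simp
    then show ?thesis
    proof (cases rule: pjoin_cases[of q x y])
      case plain
      then have s: "x q \<squnion>\<^bsub>A q\<^esub> y q = v q" using v by simp
      with join_eq_v[OF q c(1)[OF q] c(2)[OF q]] have "x q = v q \<or> y q = v q" by simp
      then show ?thesis
        using plain(2)[OF pq s] w(2,3) pq v unfolding P_le by metis
    qed (use v v_neq_tp[OF q] in auto)
  qed
  with coord show ?thesis unfolding P_le by blast
qed

end

lemma lub: "\<lbrakk>x \<in> carrier P; y \<in> carrier P\<rbrakk> \<Longrightarrow> least P (pjoin x y) (Upper P {x, y})"
  using pjoin_upper[of x y] pjoin_upper[of y x] pjoin_closed[of x y] pjoin_least[of x y]
  by (auto simp: least_def Upper_def pjoin_commute)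

lemma P_lattice: "lattice P"
proof -
  have "upper_semilattice P"
    using P_partial_order lub by (auto simp: upper_semilattice_def upper_semilattice_axioms_def)
  \<comment> \<open>Meets are the joins of the dual pruned product.\<close>
  moreover have "lower_semilattice P"
    using P_partial_order pruned_product.lub[OF dual, unfolded pruned_dual]
    by (auto simp: lower_semilattice_def lower_semilattice_axioms_def)
  ultimately show ?thesis by (rule lattice.intro)
qed

lemma P_join: 
  assumes "x \<in> carrier P" "y \<in> carrier P"
  shows "x \<squnion>\<^bsub>P\<^esub> y = pjoin x y"
proof -
  interpret lattice P by (rule P_lattice)
  show ?thesis
    by (rule join_eqI[OF assms pjoin_closed[OF assms] pjoin_upper[OF assms]])
      (use assms pjoin_upper[of y x] pjoin_least[OF assms] in \<open>simp_all add: pjoin_commute\<close>)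
qed

text \<open>Raises occur only where the componentwise join equals the separator. This is what makes
  the later diagonal map a homomorphism.\<close>

lemma P_join_componentwise:
  assumes xy: "x \<in> carrier P" "y \<in> carrier P" and z: "z \<in> carrier P"
    and eq: "\<forall>i\<in>I. x i \<squnion>\<^bsub>A i\<^esub> y i = z i" and free: "\<forall>i\<in>I. z i \<noteq> v i"
  shows "x \<squnion>\<^bsub>P\<^esub> y = z"
proof (rule P_eqI)
  show "x \<squnion>\<^bsub>P\<^esub> y \<in> carrier P" using xy by (simp add: P_join pjoin_closed)
  show "(x \<squnion>\<^bsub>P\<^esub> y) i = z i" if "i \<in> I" for i
    using xy eq free that by (simp add: P_join pjoin_eq)
qed (rule z)

lemma P_meet_componentwise:
  assumes "x \<in> carrier P" "y \<in> carrier P" "z \<in> carrier P"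
    "\<forall>i\<in>I. x i \<sqinter>\<^bsub>A i\<^esub> y i = z i" "\<forall>i\<in>I. z i \<noteq> v i"
  shows "x \<sqinter>\<^bsub>P\<^esub> y = z"
  using pruned_product.P_join_componentwise[OF dual, unfolded pruned_dual, of x y z] assms by simp

end

section \<open>Congruences of a pruned product of simple lattices\<close>

text \<open>The kernel of the projection to the coordinates in \<open>J\<close>.\<close>

definition agree :: "('i \<Rightarrow> 'b, 'm) gorder_scheme \<Rightarrow> 'i set \<Rightarrow> ('i \<Rightarrow> 'b) rel" where
  "agree L J = {(x, y) \<in> carrier L \<times> carrier L. \<forall>i\<in>J. x i = y i}"

lemma agree_dual: "agree (inv_gorder L) J = agree L J"
  by (simp add: agree_def)

lemma agree_equiv: "equiv (carrier L) (agree L J)"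
  by (rule equivI) (auto simp: agree_def refl_on_def sym_def trans_def)

context pruned_product
begin

text \<open>The join at \<open>q\<close> is computed from the arguments at \<open>q\<close> and from
  data at the predecessors of \<open>q\<close>. As \<open>J\<close> is closed under predecessors,
  the coordinates in \<open>J\<close> determine the join on \<open>J\<close>.\<close>

lemma agree_join:
  assumes J: "J \<subseteq> I" "\<forall>p q. (p, q) \<in> R \<longrightarrow> q \<in> J \<longrightarrow> p \<in> J"
    and xy: "(x, y) \<in> agree P J" and w: "w \<in> carrier P"
  shows "(x \<squnion>\<^bsub>P\<^esub> w, y \<squnion>\<^bsub>P\<^esub> w) \<in> agree P J"
proof -
  have c: "x \<in> carrier P" "y \<in> carrier P" and e: "\<And>i. i \<in> J \<Longrightarrow> x i = y i"
    using xy by (auto simp: agree_def)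
  have "pjoin x w q = pjoin y w q" if "q \<in> J" for q
    using wf_R that
  proof (induction q rule: wf_induct_rule)
    case (less q)
    have IH: "pjoin x w p = pjoin y w p \<and> x p = y p" if "(p, q) \<in> R" for p
      using less.IH[OF that] e J(2) that less.prems by blast
    have q: "q \<in> I" using less.prems J by blast
    have "(\<exists>p. (p, q) \<in> R \<and> Q (pjoin x w p) (x p) (w p)) \<longleftrightarrow> (\<exists>p. (p, q) \<in> R \<and> Q (pjoin y w p) (y p) (w p))"
      for Q using IH by metis
    from this[of "\<lambda>z a b. y q = v q \<and> z \<noteq> a \<or> w q = v q \<and> z \<noteq> b"]
    show ?case
      unfolding pjoin_eq[OF q, of x w] pjoin_eq[OF q, of y w] e[OF less.prems] by (simp only:)
  qed
  then show ?thesis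
    using c w by (simp add: agree_def P_join pjoin_closed)
qed

lemma agree_cong:
  assumes J: "J \<subseteq> I" "\<forall>p q. (p, q) \<in> R \<longrightarrow> q \<in> J \<longrightarrow> p \<in> J"
  shows "lattice_congruence P (agree P J)"
proof (rule lattice_congruenceI[OF P_lattice agree_equiv agree_join[OF J]])
  fix x y w assume "(x, y) \<in> agree P J" "w \<in> carrier P"
  then show "(x \<sqinter>\<^bsub>P\<^esub> w, y \<sqinter>\<^bsub>P\<^esub> w) \<in> agree P J"
    using pruned_product.agree_join[OF dual J, unfolded pruned_dual agree_dual] by simp
qed

section \<open>Coordinate lines and the congruences induced on them\<close>

lemma P_le_free:
  assumes "\<And>i. i \<in> I \<Longrightarrow> x i \<sqsubseteq>\<^bsub>A i\<^esub> y i" "\<And>i. i \<in> I \<Longrightarrow> x i \<noteq> v i \<or> y i \<noteq> v i"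
  shows "x \<sqsubseteq>\<^bsub>P\<^esub> y"
  using assms R_I unfolding P_le by blast

lemma P_update: "\<lbrakk>c \<in> carrier P; i \<in> I; s \<in> carrier (A i)\<rbrakk> \<Longrightarrow> c(i := s) \<in> carrier P"
  by (auto simp: P_carrier PiE_iff extensional_def)

text \<open>A line in direction \<open>i\<close> is a copy of \<open>A i\<close> only if its base point avoids the separators.\<close>

lemma fiber_join:
  assumes c: "c \<in> carrier P" "\<forall>k\<in>I. c k \<noteq> v k" and i: "i \<in> I" and st: "s \<in> carrier (A i)" "t \<in> carrier (A i)"
  shows "c(i := s) \<squnion>\<^bsub>P\<^esub> c(i := t) = c(i := s \<squnion>\<^bsub>A i\<^esub> t)"
proof -
  interpret lattice P by (rule P_lattice)
  note j = A_join[OF i st]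
  have cc: "c(i := s) \<in> carrier P" "c(i := t) \<in> carrier P" "c(i := s \<squnion>\<^bsub>A i\<^esub> t) \<in> carrier P"
    using P_update[OF c(1) i] st j(1) by simp_all
  have fib: "c(i := a) \<sqsubseteq>\<^bsub>P\<^esub> c(i := b)" if "a \<sqsubseteq>\<^bsub>A i\<^esub> b" for a b
    using that c(2) R_irrefl A_refl P_coord[OF c(1)] unfolding P_le by (auto dest: R_I)
  show ?thesis
  proof (rule join_eqI[OF cc fib[OF j(2)] fib[OF j(3)]])
    fix w assume w: "w \<in> carrier P" "c(i := s) \<sqsubseteq>\<^bsub>P\<^esub> w" "c(i := t) \<sqsubseteq>\<^bsub>P\<^esub> w"
    have wi: "s \<sqsubseteq>\<^bsub>A i\<^esub> w i" "t \<sqsubseteq>\<^bsub>A i\<^esub> w i"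
      using w(2,3) i unfolding P_le by (metis fun_upd_same)+
    have "(c(i := s \<squnion>\<^bsub>A i\<^esub> t)) k \<sqsubseteq>\<^bsub>A k\<^esub> w k" if "k \<in> I" for k
      using w(2) that j(4)[OF P_coord[OF w(1) i] wi] unfolding P_le by (cases "k = i") auto
    moreover have "(c(i := s \<squnion>\<^bsub>A i\<^esub> t)) p = w p"
      if pq: "(p, q) \<in> R" and v: "(c(i := s \<squnion>\<^bsub>A i\<^esub> t)) q = v q" "w q = v q" for p q
    proof (cases "q = i")
      case True
      then have "p \<noteq> i" using pq R_irrefl by blast
      moreover have "s = v i \<or> t = v i" using join_eq_v[OF i st] v True by simp
      ultimately show ?thesis
        using w(2,3) pq v(2) True unfolding P_le by (metis fun_upd_apply)
    next
      case False
      then show ?thesis using v(1) c(2) R_I[OF pq] by simp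
    qed
    ultimately show "c(i := s \<squnion>\<^bsub>A i\<^esub> t) \<sqsubseteq>\<^bsub>P\<^esub> w" unfolding P_le by blast
  qed
qed

lemma fiber_meet:
  assumes "c \<in> carrier P" "\<forall>k\<in>I. c k \<noteq> v k" "i \<in> I" "s \<in> carrier (A i)" "t \<in> carrier (A i)"
  shows "c(i := s) \<sqinter>\<^bsub>P\<^esub> c(i := t) = c(i := s \<sqinter>\<^bsub>A i\<^esub> t)"
  using pruned_product.fiber_join[OF dual, unfolded pruned_dual, of c i s t] assms by simp

text \<open>The map \<open>s \<mapsto> c(i := s)\<close> preserves joins and meets, so a congruence
  can be pulled back along it; simplicity of \<open>A i\<close> then becomes applicable.\<close>

lemma fiber_cong:
  assumes c: "c \<in> carrier P" "\<forall>k\<in>I. c k \<noteq> v k" and i: "i \<in> I" and \<Psi>: "lattice_congruence P \<Psi>"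
  shows "lattice_congruence (A i) {(s, t) \<in> carrier (A i) \<times> carrier (A i). (c(i := s), c(i := t)) \<in> \<Psi>}"
    (is "lattice_congruence _ ?\<rho>")
proof -
  have C: "lattice_cong P \<Psi>" by (rule lattice_congI[OF P_lattice \<Psi>])
  interpret Ai: lattice "A i" by (rule A_lattice[OF i])
  note [simp] = fiber_join[OF c i] fiber_meet[OF c i]
  show ?thesis
  proof (rule lattice_congruenceI[OF A_lattice[OF i]])
    show "equiv (carrier (A i)) ?\<rho>"
      using lattice_cong.cong_refl[OF C P_update[OF c(1) i]] lattice_cong.cong_sym[OF C] lattice_cong.cong_trans[OF C]
      by (intro equivI refl_onI symI transI) blast+
    fix s t w assume st: "(s, t) \<in> ?\<rho>" and w: "w \<in> carrier (A i)"
    then have st': "(c(i := s), c(i := t)) \<in> \<Psi>" "s \<in> carrier (A i)" "t \<in> carrier (A i)" by auto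
    note w' = P_update[OF c(1) i w]
    show "(s \<squnion>\<^bsub>A i\<^esub> w, t \<squnion>\<^bsub>A i\<^esub> w) \<in> ?\<rho>"
      using lattice_cong.cong_join_right[OF C st'(1) w'] st'(2,3) w by simp
    show "(s \<sqinter>\<^bsub>A i\<^esub> w, t \<sqinter>\<^bsub>A i\<^esub> w) \<in> ?\<rho>"
      using lattice_cong.cong_meet_right[OF C st'(1) w'] st'(2,3) w by simp
  qed
qed

definition zero :: "'i \<Rightarrow> 'b" where "zero = restrict bt I"
definition one :: "'i \<Rightarrow> 'b" where "one = restrict tp I"

lemma zero_closed: "zero \<in> carrier P" and one_closed: "one \<in> carrier P"
  by (auto simp: zero_def one_def P_carrier bt_closed tp_closed)

lemma zero_free: "\<forall>k\<in>I. zero k \<noteq> v k"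
  using bt_neq_v by (simp add: zero_def)

lemma zero_le: "x \<in> carrier P \<Longrightarrow> zero \<sqsubseteq>\<^bsub>P\<^esub> x"
  by (rule P_le_free) (auto simp: zero_def bt_le P_coord bt_neq_v)

text \<open>Nothing lies strictly below a bottom coordinate, so everything below a point of the line
  through \<open>zero\<close> is on that line.\<close>

lemma le_zero_update:
  assumes "z \<in> carrier P" "i \<in> I" "z \<sqsubseteq>\<^bsub>P\<^esub> zero(i := s)"
  shows "z = zero(i := z i)"
proof (rule P_eqI)
  fix k assume k: "k \<in> I"
  then show "z k = (zero(i := z i)) k"
    using assms le_bt[OF k P_coord[OF assms(1) k]] unfolding P_le by (force simp: zero_def)
qed (use assms P_update zero_closed P_coord in auto)

end

section \<open>Congruences when all factors are simple\<close>

locale simple_pruned_product = pruned_product +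
  assumes finite_I: "finite I"
    and A_simple: "\<lbrakk>i \<in> I; lattice_congruence (A i) \<rho>; (s, t) \<in> \<rho>; s \<noteq> t\<rbrakk> \<Longrightarrow> (bt i, tp i) \<in> \<rho>"
begin

lemma simple_dual: "simple_pruned_product I R (\<lambda>i. inv_gorder (A i)) v tp bt"
proof (intro simple_pruned_product.intro dual simple_pruned_product_axioms.intro finite_I)
  fix i \<rho> s t
  assume i: "i \<in> I" and \<rho>: "lattice_congruence (inv_gorder (A i)) \<rho>" and st: "(s, t) \<in> \<rho>" "s \<noteq> t"
  from \<rho> have \<rho>': "lattice_congruence (A i) \<rho>" by (simp only: lattice_congruence_dual)
  from lattice_cong.cong_sym[OF lattice_congI[OF A_lattice[OF i] \<rho>'] A_simple[OF i \<rho>' st]]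
  show "(tp i, bt i) \<in> \<rho>" .
qed

lemma fiber_collapse:
  assumes "c \<in> carrier P" "\<forall>k\<in>I. c k \<noteq> v k" "i \<in> I" "lattice_congruence P \<Psi>" "(c(i := s), c(i := t)) \<in> \<Psi>"
    "s \<in> carrier (A i)" "t \<in> carrier (A i)" "s \<noteq> t"
  shows "(c(i := bt i), c(i := tp i)) \<in> \<Psi>"
  using A_simple[OF assms(3) fiber_cong[OF assms(1-4)], of s t] assms by simp

text \<open>Meeting both elements with \<open>zero(i := tp i)\<close> moves the pair onto the line
  through \<open>zero\<close> in direction \<open>i\<close>. The two images stay distinct, and
  simplicity of \<open>A i\<close> collapses the whole line.\<close>

lemma collapse_low:
  assumes \<Psi>: "lattice_congruence P \<Psi>" and xy: "(x, y) \<in> \<Psi>" "x \<sqsubseteq>\<^bsub>P\<^esub> y"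
    and i: "i \<in> I" "x i \<noteq> y i" "y i \<noteq> v i"
  shows "(zero, zero(i := tp i)) \<in> \<Psi>"
proof -
  interpret lattice_cong P \<Psi> by (rule lattice_congI[OF P_lattice \<Psi>])
  define u where "u = zero(i := tp i)"
  have x: "x \<in> carrier P" and y: "y \<in> carrier P" using cong_carrier[OF xy(1)] by auto
  have u: "u \<in> carrier P" unfolding u_def using P_update zero_closed tp_closed i by simp
  define z z' where "z = y \<sqinter>\<^bsub>P\<^esub> u" and "z' = x \<sqinter>\<^bsub>P\<^esub> u"
  have zc: "z \<in> carrier P" "z' \<in> carrier P" using x y u by (simp_all add: z_def z'_def)
  have z_le: "z \<sqsubseteq>\<^bsub>P\<^esub> u" "z' \<sqsubseteq>\<^bsub>P\<^esub> u" "z \<sqsubseteq>\<^bsub>P\<^esub> y" "z' \<sqsubseteq>\<^bsub>P\<^esub> x"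
    using x y u by (simp_all add: z_def z'_def meet_left meet_right)
  have z_eq: "z = zero(i := z i)" "z' = zero(i := z' i)"
    using le_zero_update[OF _ i(1)] zc z_le unfolding u_def by blast+
  note c = P_coord[OF x i(1)] P_coord[OF y i(1)] P_coord[OF zc(1) i(1)] P_coord[OF zc(2) i(1)]
  have le: "z i \<sqsubseteq>\<^bsub>A i\<^esub> y i" "z' i \<sqsubseteq>\<^bsub>A i\<^esub> x i" "x i \<sqsubseteq>\<^bsub>A i\<^esub> y i"
    using z_le xy i(1) unfolding P_le by blast+
  have ac: "zero(i := y i) \<in> carrier P" using P_update zero_closed c i by simp
  \<comment> \<open>Here \<open>y i \<noteq> v i\<close> enters: no coordinate has the separator as
    value on both sides, so the comparison survives pruning and the meet keeps the full value
    \<open>y i\<close>.\<close>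
  have "zero(i := y i) \<sqsubseteq>\<^bsub>P\<^esub> y"
    by (rule P_le_free) (use i A_refl P_coord[OF y] bt_neq_v bt_le in \<open>auto simp: zero_def\<close>)
  moreover have "zero(i := y i) \<sqsubseteq>\<^bsub>P\<^esub> u"
    by (rule P_le_free) (use i A_refl c bt_neq_v bt_closed le_tp in \<open>auto simp: zero_def u_def\<close>)
  ultimately have "zero(i := y i) \<sqsubseteq>\<^bsub>P\<^esub> z"
    unfolding z_def by (rule meet_le) (use ac y u in auto)
  then have "y i \<sqsubseteq>\<^bsub>A i\<^esub> z i" unfolding P_le using i(1) by (metis fun_upd_same)
  then have zi: "z i = y i" using A_antisym[OF i(1)] le c by blast
  have "z' i \<noteq> y i"
  proof
    assume "z' i = y i"
    then have "x i = y i" using A_antisym[OF i(1) c(1,2)] le by simp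
    then show False using i by simp
  qed
  moreover have "(z', z) \<in> \<Psi>"
    unfolding z_def z'_def by (rule cong_meet_right[OF xy(1) u])
  ultimately have "(zero(i := bt i), zero(i := tp i)) \<in> \<Psi>"
    using fiber_collapse[OF zero_closed zero_free i(1) \<Psi>, of "z' i" "z i"] z_eq zi c by simp
  moreover have "zero(i := bt i) = zero" using i by (auto simp: zero_def)
  ultimately show ?thesis by simp
qed

text \<open>After passing to the meet \<open>a\<close> and the join \<open>b\<close>, at least one
  of them avoids the separator at \<open>i\<close>, as they differ there. Either
  \<open>collapse_low\<close> or its dual applies.\<close>

lemma collapse:
  assumes \<Psi>: "lattice_congruence P \<Psi>" and xy: "(x, y) \<in> \<Psi>" and i: "i \<in> I" "x i \<noteq> y i"
  shows "(zero, zero(i := tp i)) \<in> \<Psi>"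
proof -
  interpret lattice_cong P \<Psi> by (rule lattice_congI[OF P_lattice \<Psi>])
  have x: "x \<in> carrier P" and y: "y \<in> carrier P" using cong_carrier[OF xy] by auto
  define a b where "a = x \<sqinter>\<^bsub>P\<^esub> y" and "b = x \<squnion>\<^bsub>P\<^esub> y"
  have ab: "(a, b) \<in> \<Psi>" "a \<sqsubseteq>\<^bsub>P\<^esub> b" "a \<sqsubseteq>\<^bsub>P\<^esub> x" "a \<sqsubseteq>\<^bsub>P\<^esub> y" "x \<sqsubseteq>\<^bsub>P\<^esub> b" "y \<sqsubseteq>\<^bsub>P\<^esub> b"
      "a \<in> carrier P" "b \<in> carrier P"
    using x y cong_meet_join[OF xy]
    by (simp_all add: a_def b_def meet_le_join meet_left meet_right join_left join_right)
  have "a i \<noteq> b i"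
  proof
    assume *: "a i = b i"
    have "a i \<sqsubseteq>\<^bsub>A i\<^esub> x i" "a i \<sqsubseteq>\<^bsub>A i\<^esub> y i" "x i \<sqsubseteq>\<^bsub>A i\<^esub> b i" "y i \<sqsubseteq>\<^bsub>A i\<^esub> b i"
      using ab(3-6) i(1) unfolding P_le by blast+
    then have "x i = a i" "y i = a i"
      unfolding *[symmetric] using A_antisym[OF i(1)] P_coord[OF _ i(1)] x y ab(7) by blast+
    then show False using i by simp
  qed
  show ?thesis
  proof (cases "b i = v i")
    case False
    with collapse_low[OF \<Psi> ab(1,2) i(1) \<open>a i \<noteq> b i\<close>] show ?thesis by simp
  next
    case True
    with \<open>a i \<noteq> b i\<close> have ai: "b i \<noteq> a i" "a i \<noteq> v i" by auto
    define u d where "u = zero(i := tp i)" and "d = one(i := bt i)"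
    have u: "u \<in> carrier P" and d: "d \<in> carrier P"
      unfolding u_def d_def using P_update zero_closed one_closed tp_closed bt_closed i by simp_all
    have "pruned_product.zero I tp = one"
      by (simp add: pruned_product.zero_def[OF dual] one_def)
    \<comment> \<open>In the dual order \<open>a\<close> is the upper element and \<open>a i\<close>
      is not the separator, so the line through \<open>one\<close> is collapsed.\<close>
    with simple_pruned_product.collapse_low[OF simple_dual, unfolded pruned_dual lattice_congruence_dual,
        OF \<Psi> cong_sym[OF ab(1)] _ i(1) ai] ab(2)
    have "(one, d) \<in> \<Psi>" by (simp add: d_def)
    \<comment> \<open>Meeting with \<open>u\<close> carries the collapsed pair from the top line
      down to the ends of the line through \<open>zero\<close>.\<close>
    then have *: "(one \<sqinter>\<^bsub>P\<^esub> u, d \<sqinter>\<^bsub>P\<^esub> u) \<in> \<Psi>" using u by (rule cong_meet_right)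
    have "u \<sqsubseteq>\<^bsub>P\<^esub> one"
      by (rule P_le_free) (use u P_coord le_tp tp_neq_v in \<open>auto simp: one_def\<close>)
    then have 1: "one \<sqinter>\<^bsub>P\<^esub> u = u" using u one_closed by (simp add: meet_absorb2)
    have m: "d \<sqinter>\<^bsub>P\<^esub> u \<in> carrier P" "d \<sqinter>\<^bsub>P\<^esub> u \<sqsubseteq>\<^bsub>P\<^esub> d" "d \<sqinter>\<^bsub>P\<^esub> u \<sqsubseteq>\<^bsub>P\<^esub> u"
      using d u by (simp_all add: meet_left meet_right)
    from le_zero_update[OF m(1) i(1)] m(3) have e: "d \<sqinter>\<^bsub>P\<^esub> u = zero(i := (d \<sqinter>\<^bsub>P\<^esub> u) i)"
      unfolding u_def by blast
    have "(d \<sqinter>\<^bsub>P\<^esub> u) i \<sqsubseteq>\<^bsub>A i\<^esub> bt i"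
      using m(2) i(1) unfolding P_le by (metis d_def fun_upd_same)
    then have "(d \<sqinter>\<^bsub>P\<^esub> u) i = bt i" by (rule le_bt[OF i(1) P_coord[OF m(1) i(1)]])
    with e have "d \<sqinter>\<^bsub>P\<^esub> u = zero" using i(1) by (auto simp: zero_def fun_eq_iff)
    with * 1 have "(u, zero) \<in> \<Psi>" by simp
    then show ?thesis using cong_sym by (simp add: u_def)
  qed
qed

text \<open>Pruning takes effect here. Joining the collapsed pair with \<open>zero(q := v q)\<close>
  gives a comparable pair that differs at \<open>i\<close>; it cannot keep the value
  \<open>v q\<close> at \<open>q\<close> on both sides, so it differs at \<open>q\<close> too and
  \<open>collapse\<close> applies.\<close>

lemma collapse_below:
  assumes \<Psi>: "lattice_congruence P \<Psi>" and i: "(zero, zero(i := tp i)) \<in> \<Psi>" and iq: "(i, q) \<in> R"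
  shows "(zero, zero(q := tp q)) \<in> \<Psi>"
proof -
  interpret lattice_cong P \<Psi> by (rule lattice_congI[OF P_lattice \<Psi>])
  have I: "i \<in> I" "q \<in> I" using R_I[OF iq] by auto
  have iq': "i \<noteq> q" using R_irrefl iq by blast
  define c where "c = zero(q := v q)"
  define z where "z = zero(i := tp i) \<squnion>\<^bsub>P\<^esub> c"
  have c: "c \<in> carrier P" unfolding c_def using P_update zero_closed v_closed I by simp
  have u: "zero(i := tp i) \<in> carrier P" using P_update zero_closed tp_closed I by simp
  have z: "zero(i := tp i) \<sqsubseteq>\<^bsub>P\<^esub> z" "c \<sqsubseteq>\<^bsub>P\<^esub> z" "z \<in> carrier P"
    using c u by (simp_all add: z_def join_left join_right)
  have "zero \<squnion>\<^bsub>P\<^esub> c = c" using zero_le c zero_closed by (simp add: join_absorb)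
  with cong_join_right[OF i c] have cz: "(c, z) \<in> \<Psi>" by (simp add: z_def)
  have "tp i \<sqsubseteq>\<^bsub>A i\<^esub> z i" using z(1) I(1) unfolding P_le by (metis fun_upd_same)
  then have "z i = tp i" by (rule tp_le[OF I(1) P_coord[OF z(3) I(1)]])
  then have "c i \<noteq> z i" using I iq' bt_neq_tp by (simp add: c_def zero_def)
  with z(2) iq have "\<not> (c q = v q \<and> z q = v q)" unfolding P_le by blast
  then have "c q \<noteq> z q" by (auto simp: c_def)
  then show ?thesis by (rule collapse[OF \<Psi> cz I(2)])
qed

text \<open>Let \<open>S\<close> consist of the coordinates whose line through \<open>zero\<close>
  is collapsed. A congruent pair differs only on \<open>S\<close> by \<open>collapse\<close>.
  Conversely, lowering all coordinates in \<open>S\<close> to the bottom stays in the class, so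
  elements that agree off \<open>S\<close> are congruent to a common element.\<close>

lemma cong_eq_agree:
  assumes \<Psi>: "lattice_congruence P \<Psi>"
  obtains J where "J \<subseteq> I" "\<forall>p q. (p, q) \<in> R \<longrightarrow> q \<in> J \<longrightarrow> p \<in> J" "\<Psi> = agree P J"
proof
  interpret lattice_cong P \<Psi> by (rule lattice_congI[OF P_lattice \<Psi>])
  define S where "S = {i \<in> I. (zero, zero(i := tp i)) \<in> \<Psi>}"
  have S_down: "q \<in> S" if "(p, q) \<in> R" "p \<in> S" for p q
    using collapse_below[OF \<Psi> _ that(1)] that R_I[OF that(1)] by (simp add: S_def)
  show "I - S \<subseteq> I" by blast
  show "\<forall>p q. (p, q) \<in> R \<longrightarrow> q \<in> I - S \<longrightarrow> p \<in> I - S"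
    using S_down R_I by blast
  \<comment> \<open>Points with only extreme coordinates avoid every separator, so among them the
    order and the relevant joins are componentwise.\<close>
  define e where "e F = (\<lambda>i\<in>I. if i \<in> F then tp i else bt i)" for F
  have e_closed: "e F \<in> carrier P" for F
    by (auto simp: e_def P_carrier tp_closed bt_closed)
  have e_free: "e F i \<noteq> v i" if "i \<in> I" for F i
    using tp_neq_v[OF that] bt_neq_v[OF that] that by (simp add: e_def)
  have e_mono: "e F \<sqsubseteq>\<^bsub>P\<^esub> e G" if "F \<subseteq> G" for F G
  proof (rule P_le_free)
    show "e F i \<sqsubseteq>\<^bsub>A i\<^esub> e G i" if "i \<in> I" for i
      using that \<open>F \<subseteq> G\<close> by (auto simp: e_def A_refl bt_le tp_closed bt_closed)
  qed (simp add: e_free)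
  \<comment> \<open>The collapsed directions are combined one at a time; finiteness of
    \<open>I\<close> makes this reach all of \<open>S\<close>.\<close>
  have e_S: "(zero, e F) \<in> \<Psi>" if "finite F" "F \<subseteq> S" for F
    using that
  proof (induction F)
    case empty
    have "e {} = zero" by (simp add: e_def zero_def)
    then show ?case by (simp add: cong_refl zero_closed)
  next
    case (insert i F)
    then have i: "i \<in> I" "(zero, zero(i := tp i)) \<in> \<Psi>" by (auto simp: S_def)
    have u: "zero(i := tp i) = e {i}" using i(1) by (auto simp: e_def zero_def fun_eq_iff)
    have "e F \<squnion>\<^bsub>P\<^esub> e {i} = e (insert i F)"
    proof (rule join_eqI)
      fix w assume w: "w \<in> carrier P" "e F \<sqsubseteq>\<^bsub>P\<^esub> w" "e {i} \<sqsubseteq>\<^bsub>P\<^esub> w"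
      have "e (insert i F) k \<sqsubseteq>\<^bsub>A k\<^esub> w k" if k: "k \<in> I" for k
      proof -
        have "e F k \<sqsubseteq>\<^bsub>A k\<^esub> w k" "e {i} k \<sqsubseteq>\<^bsub>A k\<^esub> w k" using w k unfolding P_le by blast+
        then show ?thesis using k by (auto simp: e_def split: if_splits)
      qed
      then show "e (insert i F) \<sqsubseteq>\<^bsub>P\<^esub> w" using e_free by (intro P_le_free) auto
    qed (simp_all add: e_closed e_mono subset_insertI)
    moreover have "zero \<squnion>\<^bsub>P\<^esub> zero = zero" by (simp add: join_idem zero_closed)
    ultimately show ?case
      using cong_join[OF insert.IH i(2)] insert.prems u by simp
  qed
  have SI: "S \<subseteq> I" by (auto simp: S_def)
  then have zS: "(zero, e S) \<in> \<Psi>"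
    using e_S finite_I finite_subset by blast
  define lo hi where "lo x = (\<lambda>i\<in>I. if i \<in> S then bt i else x i)"
    and "hi x = (\<lambda>i\<in>I. if i \<in> S then tp i else x i)" for x
  have lo_cong: "(lo x, x) \<in> \<Psi>" if x: "x \<in> carrier P" for x
  proof -
    have c: "lo x \<in> carrier P" "hi x \<in> carrier P"
      using x by (auto simp: lo_def hi_def P_carrier bt_closed tp_closed)
    note xi = P_coord[OF x]
    \<comment> \<open>If a coordinate \<open>p\<close> changes, then \<open>p \<in> S\<close>, hence
      \<open>q \<in> S\<close> whenever \<open>(p, q) \<in> R\<close>; there \<open>lo x\<close> and
      \<open>hi x\<close> take extreme values, so pruning forbids nothing.\<close>
    have le: "lo x \<sqsubseteq>\<^bsub>P\<^esub> x" "x \<sqsubseteq>\<^bsub>P\<^esub> hi x" "lo x \<sqsubseteq>\<^bsub>P\<^esub> hi x"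
      unfolding P_le lo_def hi_def
      using S_down bt_neq_v tp_neq_v xi by (auto simp: A_refl bt_le le_tp tp_closed dest: R_I)
    have "lo x \<squnion>\<^bsub>P\<^esub> e S = hi x"
    proof (rule join_eqI[OF c(1) e_closed c(2) le(3)])
      show "e S \<sqsubseteq>\<^bsub>P\<^esub> hi x"
        using e_free xi by (intro P_le_free) (auto simp: e_def hi_def A_refl tp_closed bt_le)
      fix w assume w: "w \<in> carrier P" "lo x \<sqsubseteq>\<^bsub>P\<^esub> w" "e S \<sqsubseteq>\<^bsub>P\<^esub> w"
      have wS: "w k = tp k" if "k \<in> S" for k
      proof -
        have k: "k \<in> I" using that SI by blast
        have "e S k \<sqsubseteq>\<^bsub>A k\<^esub> w k" using w(3) k unfolding P_le by blast
        then show ?thesis using that k tp_le[OF k P_coord[OF w(1) k]] by (simp add: e_def)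
      qed
      have "hi x k \<sqsubseteq>\<^bsub>A k\<^esub> w k" if k: "k \<in> I" for k
      proof (cases "k \<in> S")
        case True
        then show ?thesis using wS k by (simp add: hi_def A_refl tp_closed)
      next
        case False
        have "lo x k \<sqsubseteq>\<^bsub>A k\<^esub> w k" using w(2) k unfolding P_le by blast
        then show ?thesis using False k by (simp add: hi_def lo_def)
      qed
      \<comment> \<open>Since \<open>w\<close> is top on \<open>S\<close>, the value
        \<open>v q\<close> places \<open>q\<close> outside \<open>S\<close>, where
        \<open>lo x\<close> and \<open>hi x\<close> agree. Pruning in
        \<open>lo x \<sqsubseteq> w\<close> then settles the coordinates \<open>p\<close> outside
        \<open>S\<close>; on \<open>S\<close> both sides are top.\<close>
      moreover have "hi x p = w p" if pq: "(p, q) \<in> R" and v: "hi x q = v q" "w q = v q" for p q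
      proof (cases "p \<in> S")
        case True
        then show ?thesis using wS R_I[OF pq] by (simp add: hi_def)
      next
        case False
        have q: "q \<in> I" "p \<in> I" using R_I[OF pq] by auto
        have "q \<notin> S" using wS[of q] v(2) v_neq_tp[OF q(1)] by auto
        then have "lo x q = v q" using v(1) q by (simp add: hi_def lo_def)
        then have "lo x p = w p" using w(2) pq v(2) unfolding P_le by blast
        then show ?thesis using False q by (simp add: hi_def lo_def)
      qed
      ultimately show "hi x \<sqsubseteq>\<^bsub>P\<^esub> w" unfolding P_le by blast
    qed
    moreover have "lo x \<squnion>\<^bsub>P\<^esub> zero = lo x"
      using c zero_closed zero_le by (simp add: join_absorb2)
    ultimately have "(lo x, hi x) \<in> \<Psi>"
      using cong_join[OF cong_refl[OF c(1)] zS] by simp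
    then show ?thesis
      using cong_convex[of "lo x" "hi x" "lo x" x] le c x le_refl[OF c(1)] by simp
  qed
  show "\<Psi> = agree P (I - S)"
  proof (intro equalityI subrelI)
    fix x y assume xy: "(x, y) \<in> \<Psi>"
    have "x i = y i" if "i \<in> I - S" for i
      using collapse[OF \<Psi> xy, of i] that unfolding S_def by blast
    then show "(x, y) \<in> agree P (I - S)" using cong_carrier[OF xy] by (simp add: agree_def)
  next
    fix x y assume "(x, y) \<in> agree P (I - S)"
    then have xy: "x \<in> carrier P" "y \<in> carrier P" "\<And>i. i \<in> I - S \<Longrightarrow> x i = y i"
      by (auto simp: agree_def)
    then have "lo x = lo y" by (auto simp: lo_def fun_eq_iff)
    then show "(x, y) \<in> \<Psi>" using lo_cong[OF xy(1)] lo_cong[OF xy(2)] cong_sym cong_trans by metis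
  qed
qed

text \<open>A class is given by fixed values on \<open>J\<close>, and overwriting them by those of
  another class is a bijection. It respects the order because the fixed values never influence
  comparisons within a class.\<close>

lemma agree_isoform:
  assumes J: "J \<subseteq> I" "\<forall>p q. (p, q) \<in> R \<longrightarrow> q \<in> J \<longrightarrow> p \<in> J"
  shows "isoform_congruence P (agree P J)"
  unfolding isoform_congruence_def
proof (intro ballI)
  fix X Y assume XY: "X \<in> carrier P // agree P J" "Y \<in> carrier P // agree P J"
  have cls: "\<exists>x\<in>carrier P. X = {z \<in> carrier P. \<forall>i\<in>J. z i = x i}" if "X \<in> carrier P // agree P J" for X
  proof -
    from that obtain x where x: "x \<in> carrier P" "X = agree P J `` {x}" by (rule quotientE)
    then have "X = {z \<in> carrier P. \<forall>i\<in>J. z i = x i}" by (simp add: agree_def set_eq_iff eq_commute)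
    with x(1) show ?thesis by blast
  qed
  obtain x y where x: "x \<in> carrier P" "X = {z \<in> carrier P. \<forall>i\<in>J. z i = x i}"
    and y: "y \<in> carrier P" "Y = {z \<in> carrier P. \<forall>i\<in>J. z i = y i}"
    using cls[OF XY(1)] cls[OF XY(2)] by (elim bexE)
  define f where "f y z = (\<lambda>i\<in>I. if i \<in> J then y i else z i)" for y z :: "'a \<Rightarrow> 'b"
  have fc: "f y z \<in> carrier P" if "y \<in> carrier P" "z \<in> carrier P" for y z
    using that by (auto simp: f_def P_carrier)
  have inv: "f x (f y z) = z" if "x \<in> carrier P" "z \<in> carrier P" "\<forall>i\<in>J. z i = x i" for x y z
    using that by (intro P_eqI) (auto simp: f_def P_carrier)
  have bij: "bij_betw (f y) X Y"
    by (rule bij_betw_byWitness[where f' = "f x"])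
      (use x y J fc inv in \<open>auto simp: f_def\<close>)
  have le: "f y a \<sqsubseteq>\<^bsub>P\<^esub> f y b \<longleftrightarrow> a \<sqsubseteq>\<^bsub>P\<^esub> b" if "a \<in> X" "b \<in> X" for a b
  proof -
    have ab: "a \<in> carrier P" "b \<in> carrier P" "\<And>i. i \<in> J \<Longrightarrow> a i = b i" using that x by auto
    have "(f y a i \<sqsubseteq>\<^bsub>A i\<^esub> f y b i) \<longleftrightarrow> (a i \<sqsubseteq>\<^bsub>A i\<^esub> b i)" if "i \<in> I" for i
      using that ab(3)[of i] A_refl[OF that P_coord[OF ab(2) that]] A_refl[OF that P_coord[OF y(1) that]]
      by (auto simp: f_def)
    \<comment> \<open>For \<open>q \<in> J\<close> also \<open>p \<in> J\<close>, and both
      conclusions hold trivially; for \<open>q\<close> outside \<open>J\<close> the premises are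
      unchanged by \<open>f y\<close>, and equality at \<open>p\<close> is either trivial or
      unchanged.\<close>
    moreover have "(f y a q = v q \<longrightarrow> f y b q = v q \<longrightarrow> f y a p = f y b p) \<longleftrightarrow>
        (a q = v q \<longrightarrow> b q = v q \<longrightarrow> a p = b p)" if "(p, q) \<in> R" for p q
      using R_I[OF that] ab(3)[of p] ab(3)[of q] J(2) that by (auto simp: f_def)
    ultimately show ?thesis unfolding P_le by blast
  qed
  have lat: "lattice (P\<lparr>carrier := X\<rparr>)" "lattice (P\<lparr>carrier := Y\<rparr>)"
    using congruence_class_sublattice(1)[OF P_lattice agree_cong[OF J]] XY by blast+
  have "f y \<in> lattice_hom (P\<lparr>carrier := X\<rparr>) (P\<lparr>carrier := Y\<rparr>)"
    by (rule order_iso_lattice_hom[OF lat]) (use bij le in auto)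
  then show "lattice_isomorphic (P\<lparr>carrier := X\<rparr>) (P\<lparr>carrier := Y\<rparr>)"
    unfolding lattice_isomorphic_def using bij by auto
qed

lemma P_isoform: "isoform P"
  unfolding isoform_def
proof (intro allI impI)
  fix \<Psi> assume "lattice_congruence P \<Psi>"
  then obtain J where J: "J \<subseteq> I" "\<forall>p q. (p, q) \<in> R \<longrightarrow> q \<in> J \<longrightarrow> p \<in> J" "\<Psi> = agree P J"
    by (rule cong_eq_agree)
  show "isoform_congruence P \<Psi>" unfolding J(3) by (rule agree_isoform[OF J(1,2)])
qed

end

section \<open>Quotient lattices\<close>

definition class_rep :: "'a rel \<Rightarrow> 'a \<Rightarrow> 'a" where
  "class_rep \<Theta> x = (SOME y. (x, y) \<in> \<Theta>)"

text \<open>The quotient lattice is carried by a system of representatives of the congruence classes.\<close>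

definition quotient_lattice :: "('a, 'm) gorder_scheme \<Rightarrow> 'a rel \<Rightarrow> 'a gorder" where
  "quotient_lattice L \<Theta> = \<lparr>carrier = class_rep \<Theta> ` carrier L, eq = (=),
     le = (\<lambda>x y. (x \<squnion>\<^bsub>L\<^esub> y, y) \<in> \<Theta>)\<rparr>"

context lattice_cong
begin

abbreviation rep where "rep \<equiv> class_rep \<Theta>"
abbreviation Q where "Q \<equiv> quotient_lattice L \<Theta>"

lemma rep_cong: "x \<in> carrier L \<Longrightarrow> (x, rep x) \<in> \<Theta>"
  unfolding class_rep_def by (rule someI) (rule cong_refl)

text \<open>Congruent elements define the same choice predicate, so the chosen representative
  depends only on the class.\<close>

lemma rep_eq_iff:
  assumes "x \<in> carrier L" "y \<in> carrier L"
  shows "rep x = rep y \<longleftrightarrow> (x, y) \<in> \<Theta>"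
proof
  assume "rep x = rep y"
  then show "(x, y) \<in> \<Theta>" using rep_cong assms cong_sym cong_trans by metis
next
  assume "(x, y) \<in> \<Theta>"
  then have "(x, z) \<in> \<Theta> \<longleftrightarrow> (y, z) \<in> \<Theta>" for z using cong_sym cong_trans by blast
  then show "rep x = rep y" by (simp add: class_rep_def)
qed

lemma Q_carrier: "carrier Q = rep ` carrier L"
  by (simp add: quotient_lattice_def)

lemma Q_le:
  assumes "x \<in> carrier L" "y \<in> carrier L"
  shows "rep x \<sqsubseteq>\<^bsub>Q\<^esub> rep y \<longleftrightarrow> (x \<squnion> y, y) \<in> \<Theta>"
proof -
  have y: "(y, rep y) \<in> \<Theta>" by (rule rep_cong[OF assms(2)])
  have xy: "(x \<squnion> y, rep x \<squnion> rep y) \<in> \<Theta>" by (rule cong_join[OF rep_cong[OF assms(1)] y])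
  have "(rep x \<squnion> rep y, rep y) \<in> \<Theta> \<longleftrightarrow> (x \<squnion> y, y) \<in> \<Theta>"
    using cong_trans[OF cong_trans[OF xy] cong_sym[OF y]] cong_trans[OF cong_trans[OF cong_sym[OF xy]] y]
    by blast
  then show ?thesis by (simp add: quotient_lattice_def)
qed

text \<open>By absorption, meeting the first relation with \<open>x\<close> gives the second, and
  joining the second with \<open>y\<close> gives the first. This form of the order suits lower
  bounds.\<close>

lemma Q_le_meet:
  assumes "x \<in> carrier L" "y \<in> carrier L"
  shows "rep x \<sqsubseteq>\<^bsub>Q\<^esub> rep y \<longleftrightarrow> (x \<sqinter> y, x) \<in> \<Theta>"
  unfolding Q_le[OF assms]
proof
  assume "(x \<squnion> y, y) \<in> \<Theta>"
  from cong_meet_right[OF this assms(1)] have "(x, y \<sqinter> x) \<in> \<Theta>"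
    using assms by (simp add: meet_absorb2 join_left)
  then show "(x \<sqinter> y, x) \<in> \<Theta>" using cong_sym by (simp add: meet_comm)
next
  assume "(x \<sqinter> y, x) \<in> \<Theta>"
  from cong_join_right[OF this assms(2)] have "(y, x \<squnion> y) \<in> \<Theta>"
    using assms by (simp add: join_absorb meet_right)
  then show "(x \<squnion> y, y) \<in> \<Theta>" using cong_sym by simp
qed

lemma Q_partial_order: "partial_order Q"
proof (rule partial_orderI_eq)
  show "eq Q = (=)" by (simp add: quotient_lattice_def)
next
  fix a assume "a \<in> carrier Q"
  then obtain x where "x \<in> carrier L" "a = rep x" by (auto simp: Q_carrier)
  then show "a \<sqsubseteq>\<^bsub>Q\<^esub> a" by (simp add: Q_le join_idem cong_refl)
next
  fix a b assume "a \<in> carrier Q" "b \<in> carrier Q" and le: "a \<sqsubseteq>\<^bsub>Q\<^esub> b" "b \<sqsubseteq>\<^bsub>Q\<^esub> a"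
  then obtain x y where xy: "x \<in> carrier L" "a = rep x" "y \<in> carrier L" "b = rep y" by (auto simp: Q_carrier)
  with le have "(x \<squnion> y, y) \<in> \<Theta>" "(x \<squnion> y, x) \<in> \<Theta>" by (simp_all add: Q_le join_comm[of L x y])
  then have "(x, y) \<in> \<Theta>" using cong_sym cong_trans by blast
  then show "a = b" using xy by (simp add: rep_eq_iff)
next
  fix a b c assume "a \<in> carrier Q" "b \<in> carrier Q" "c \<in> carrier Q" and le: "a \<sqsubseteq>\<^bsub>Q\<^esub> b" "b \<sqsubseteq>\<^bsub>Q\<^esub> c"
  then obtain x y z where xyz: "x \<in> carrier L" "a = rep x" "y \<in> carrier L" "b = rep y" "z \<in> carrier L" "c = rep z"
    by (auto simp: Q_carrier)
  with le have xy: "(x \<squnion> y, y) \<in> \<Theta>" and yz: "(y \<squnion> z, z) \<in> \<Theta>" by (simp_all add: Q_le)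
  have "(x \<squnion> (y \<squnion> z), x \<squnion> z) \<in> \<Theta>" using cong_join[OF cong_refl[OF xyz(1)] yz] .
  moreover have "((x \<squnion> y) \<squnion> z, y \<squnion> z) \<in> \<Theta>" using cong_join_right[OF xy xyz(5)] .
  moreover have "(x \<squnion> y) \<squnion> z = x \<squnion> (y \<squnion> z)"
    using weak_join_assoc[OF xyz(1,3,5)] eq_is_equal by simp
  ultimately have "(x \<squnion> z, z) \<in> \<Theta>" using yz cong_sym cong_trans by metis
  then show "a \<sqsubseteq>\<^bsub>Q\<^esub> c" using xyz by (simp add: Q_le)
qed

lemma Q_bounds:
  assumes "x \<in> carrier L" "y \<in> carrier L"
  shows "least Q (rep (x \<squnion> y)) (Upper Q {rep x, rep y})"
    and "greatest Q (rep (x \<sqinter> y)) (Lower Q {rep x, rep y})"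
proof -
  have "rep x \<sqsubseteq>\<^bsub>Q\<^esub> rep (x \<squnion> y)" "rep y \<sqsubseteq>\<^bsub>Q\<^esub> rep (x \<squnion> y)"
    using assms by (simp_all add: Q_le join_absorb join_left join_right cong_refl)
  moreover have "rep (x \<squnion> y) \<sqsubseteq>\<^bsub>Q\<^esub> rep z"
    if "z \<in> carrier L" "rep x \<sqsubseteq>\<^bsub>Q\<^esub> rep z" "rep y \<sqsubseteq>\<^bsub>Q\<^esub> rep z" for z
  proof -
    have xz: "(x \<squnion> z, z) \<in> \<Theta>" "(y \<squnion> z, z) \<in> \<Theta>" using that assms by (simp_all add: Q_le)
    have "(x \<squnion> (y \<squnion> z), x \<squnion> z) \<in> \<Theta>" using cong_join[OF cong_refl[OF assms(1)] xz(2)] .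
    then have "((x \<squnion> y) \<squnion> z, x \<squnion> z) \<in> \<Theta>"
      using weak_join_assoc[OF assms that(1)] eq_is_equal by simp
    from cong_trans[OF this xz(1)] show ?thesis using assms that(1) by (simp add: Q_le)
  qed
  ultimately show "least Q (rep (x \<squnion> y)) (Upper Q {rep x, rep y})"
    using assms by (auto simp: least_def Upper_def Q_carrier)
  have "rep (x \<sqinter> y) \<sqsubseteq>\<^bsub>Q\<^esub> rep x" "rep (x \<sqinter> y) \<sqsubseteq>\<^bsub>Q\<^esub> rep y"
    using assms by (simp_all add: Q_le join_absorb meet_left meet_right cong_refl)
  moreover have "rep z \<sqsubseteq>\<^bsub>Q\<^esub> rep (x \<sqinter> y)"
    if "z \<in> carrier L" "rep z \<sqsubseteq>\<^bsub>Q\<^esub> rep x" "rep z \<sqsubseteq>\<^bsub>Q\<^esub> rep y" for z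
  proof -
    have xz: "(z \<sqinter> x, z) \<in> \<Theta>" "(z \<sqinter> y, z) \<in> \<Theta>" using that assms by (simp_all add: Q_le_meet)
    have "((z \<sqinter> x) \<sqinter> y, z \<sqinter> y) \<in> \<Theta>" using cong_meet_right[OF xz(1) assms(2)] .
    then have "(z \<sqinter> (x \<sqinter> y), z \<sqinter> y) \<in> \<Theta>"
      using weak_meet_assoc[OF that(1) assms] eq_is_equal by simp
    from cong_trans[OF this xz(2)] show ?thesis using assms that(1) by (simp add: Q_le_meet)
  qed
  ultimately show "greatest Q (rep (x \<sqinter> y)) (Lower Q {rep x, rep y})"
    using assms by (auto simp: greatest_def Lower_def Q_carrier)
qed

lemma Q_lattice: "lattice Q"
proof -
  have "upper_semilattice Q"
    unfolding upper_semilattice_def upper_semilattice_axioms_def Q_carrier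
    using Q_partial_order Q_bounds(1) by blast
  moreover have "lower_semilattice Q"
    unfolding lower_semilattice_def lower_semilattice_axioms_def Q_carrier
    using Q_partial_order Q_bounds(2) by blast
  ultimately show ?thesis by (rule lattice.intro)
qed

lemma
  assumes "x \<in> carrier L" "y \<in> carrier L"
  shows Q_join: "rep x \<squnion>\<^bsub>Q\<^esub> rep y = rep (x \<squnion> y)" and Q_meet: "rep x \<sqinter>\<^bsub>Q\<^esub> rep y = rep (x \<sqinter> y)"
proof -
  interpret Q: lattice Q by (rule Q_lattice)
  have "rep x \<in> carrier Q" "rep y \<in> carrier Q" using assms by (simp_all add: Q_carrier)
  then show "rep x \<squnion>\<^bsub>Q\<^esub> rep y = rep (x \<squnion> y)" "rep x \<sqinter>\<^bsub>Q\<^esub> rep y = rep (x \<sqinter> y)"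
    using Q.least_unique[OF _ Q_bounds(1)[OF assms]] Q.greatest_unique[OF _ Q_bounds(2)[OF assms]]
      Q.sup_of_two_least Q.inf_of_two_greatest by (simp_all add: join_def meet_def)
qed

end

section \<open>Simple extensions with separators\<close>

text \<open>A lattice \<open>Q\<close> gets new bounds, two separators \<open>Sep True\<close>, \<open>Sep False\<close> (each both an atom and
  a coatom), and for every \<open>a\<close> in \<open>Q\<close> a coatom \<open>Coat a\<close> whose lower covers are \<open>a\<close> and the new atom
  \<open>Atom a\<close>.\<close>

datatype 'a simp_ext = Bot | Top | Sep bool | In 'a | Atom 'a | Coat 'a

text \<open>The relation is written out already transitively closed: \<open>In a\<close> is below
  \<open>Coat b\<close> for every \<open>a \<sqsubseteq> b\<close>, not merely for
  \<open>a = b\<close>.\<close>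

definition simp_ext_le :: "('a, 'm) gorder_scheme \<Rightarrow> 'a simp_ext \<Rightarrow> 'a simp_ext \<Rightarrow> bool" where
  "simp_ext_le Q x y \<longleftrightarrow> x = Bot \<or> y = Top \<or> x = y \<or>
     (\<exists>a b. x = In a \<and> (y = In b \<or> y = Coat b) \<and> a \<sqsubseteq>\<^bsub>Q\<^esub> b) \<or> (\<exists>a. x = Atom a \<and> y = Coat a)"

definition simple_extension :: "('a, 'm) gorder_scheme \<Rightarrow> 'a simp_ext gorder" where
  "simple_extension Q = \<lparr>carrier = {Bot, Top} \<union> range Sep \<union> In ` carrier Q \<union> Atom ` carrier Q \<union> Coat ` carrier Q,
     eq = (=), le = simp_ext_le Q\<rparr>"

text \<open>Comparable pairs are settled first. Otherwise \<open>In a\<close> and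
  \<open>Atom b\<close> can have only \<open>Coat b\<close> and \<open>Top\<close> as common upper
  bounds.\<close>

definition simp_ext_join :: "('a, 'm) gorder_scheme \<Rightarrow> 'a simp_ext \<Rightarrow> 'a simp_ext \<Rightarrow> 'a simp_ext" where
  "simp_ext_join Q x y = (if simp_ext_le Q x y then y else if simp_ext_le Q y x then x else
     case (x, y) of
       (In a, In b) \<Rightarrow> In (a \<squnion>\<^bsub>Q\<^esub> b)
     | (In a, Atom b) \<Rightarrow> if a \<sqsubseteq>\<^bsub>Q\<^esub> b then Coat b else Top
     | (Atom b, In a) \<Rightarrow> if a \<sqsubseteq>\<^bsub>Q\<^esub> b then Coat b else Top
     | _ \<Rightarrow> Top)"

text \<open>Two distinct coatoms \<open>Coat a\<close> and \<open>Coat b\<close> share no new atom,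
  so their meet is found inside \<open>Q\<close>.\<close>

definition simp_ext_meet :: "('a, 'm) gorder_scheme \<Rightarrow> 'a simp_ext \<Rightarrow> 'a simp_ext \<Rightarrow> 'a simp_ext" where
  "simp_ext_meet Q x y = (if simp_ext_le Q x y then x else if simp_ext_le Q y x then y else
     case (x, y) of
       (In a, In b) \<Rightarrow> In (a \<sqinter>\<^bsub>Q\<^esub> b)
     | (In a, Coat b) \<Rightarrow> In (a \<sqinter>\<^bsub>Q\<^esub> b)
     | (Coat a, In b) \<Rightarrow> In (a \<sqinter>\<^bsub>Q\<^esub> b)
     | (Coat a, Coat b) \<Rightarrow> In (a \<sqinter>\<^bsub>Q\<^esub> b)
     | _ \<Rightarrow> Bot)"

lemma simp_ext_le_simps [simp]:
  "simp_ext_le Q Bot y" "simp_ext_le Q x Top"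
  "simp_ext_le Q x Bot \<longleftrightarrow> x = Bot" "simp_ext_le Q Top y \<longleftrightarrow> y = Top"
  "simp_ext_le Q (Sep i) y \<longleftrightarrow> y = Top \<or> y = Sep i" "simp_ext_le Q x (Sep i) \<longleftrightarrow> x = Bot \<or> x = Sep i"
  "simp_ext_le Q (Atom a) y \<longleftrightarrow> y = Top \<or> y = Atom a \<or> y = Coat a"
  "simp_ext_le Q x (Atom a) \<longleftrightarrow> x = Bot \<or> x = Atom a"
  "simp_ext_le Q (Coat a) y \<longleftrightarrow> y = Top \<or> y = Coat a"
  "simp_ext_le Q (In a) (In b) \<longleftrightarrow> a = b \<or> a \<sqsubseteq>\<^bsub>Q\<^esub> b"
  "simp_ext_le Q (In a) (Coat b) \<longleftrightarrow> a \<sqsubseteq>\<^bsub>Q\<^esub> b"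
  by (auto simp: simp_ext_le_def)

lemma simple_extension_simps:
  "carrier (simple_extension Q) = {Bot, Top} \<union> range Sep \<union> In ` carrier Q \<union> Atom ` carrier Q \<union> Coat ` carrier Q"
  "le (simple_extension Q) = simp_ext_le Q"
  "eq (simple_extension Q) = (=)"
  by (simp_all add: simple_extension_def)

lemma simple_extension_mem [simp]:
  "Bot \<in> carrier (simple_extension Q)" "Top \<in> carrier (simple_extension Q)"
  "Sep i \<in> carrier (simple_extension Q)"
  "In a \<in> carrier (simple_extension Q) \<longleftrightarrow> a \<in> carrier Q"
  "Atom a \<in> carrier (simple_extension Q) \<longleftrightarrow> a \<in> carrier Q"
  "Coat a \<in> carrier (simple_extension Q) \<longleftrightarrow> a \<in> carrier Q"
  by (auto simp: simple_extension_def)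

context lattice
begin

abbreviation E where "E \<equiv> simple_extension L"

lemma E_partial_order: "partial_order E"
proof (rule partial_orderI_eq)
  fix x y z
  show "eq E = (=)" by (simp add: simple_extension_def)
  show "x \<sqsubseteq>\<^bsub>E\<^esub> x" by (simp add: simple_extension_simps simp_ext_le_def)
  assume xy: "x \<in> carrier E" "y \<in> carrier E" "x \<sqsubseteq>\<^bsub>E\<^esub> y"
  show "x = y" if "y \<sqsubseteq>\<^bsub>E\<^esub> x"
    using xy that by (cases x; cases y) (simp_all add: simple_extension_simps(2), metis le_antisym)
  assume "z \<in> carrier E" "y \<sqsubseteq>\<^bsub>E\<^esub> z"
  with xy show "x \<sqsubseteq>\<^bsub>E\<^esub> z"
    by (cases x; cases y; cases z) (simp_all add: simple_extension_simps(2), (metis le_trans)+)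
qed

lemma simp_ext_join_bound:
  assumes "x \<in> carrier E" "y \<in> carrier E"
  shows "simp_ext_join L x y \<in> carrier E \<and> x \<sqsubseteq>\<^bsub>E\<^esub> simp_ext_join L x y \<and> y \<sqsubseteq>\<^bsub>E\<^esub> simp_ext_join L x y"
  using assms
  by (cases x; cases y) (simp_all add: simp_ext_join_def simple_extension_simps(2) join_left join_right)

lemma simp_ext_join_least:
  assumes "x \<in> carrier E" "y \<in> carrier E" "w \<in> carrier E" "x \<sqsubseteq>\<^bsub>E\<^esub> w" "y \<sqsubseteq>\<^bsub>E\<^esub> w"
  shows "simp_ext_join L x y \<sqsubseteq>\<^bsub>E\<^esub> w"
  using assms
  by (cases x; cases y; cases w) (simp_all add: simp_ext_join_def simple_extension_simps(2), (metis join_le le_refl)+)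

lemma simp_ext_meet_bound:
  assumes "x \<in> carrier E" "y \<in> carrier E"
  shows "simp_ext_meet L x y \<in> carrier E \<and> simp_ext_meet L x y \<sqsubseteq>\<^bsub>E\<^esub> x \<and> simp_ext_meet L x y \<sqsubseteq>\<^bsub>E\<^esub> y"
  using assms
  by (cases x; cases y) (simp_all add: simp_ext_meet_def simple_extension_simps(2) meet_left meet_right)

lemma simp_ext_meet_greatest:
  assumes "x \<in> carrier E" "y \<in> carrier E" "w \<in> carrier E" "w \<sqsubseteq>\<^bsub>E\<^esub> x" "w \<sqsubseteq>\<^bsub>E\<^esub> y"
  shows "w \<sqsubseteq>\<^bsub>E\<^esub> simp_ext_meet L x y"
  using assms
  by (cases x; cases y; cases w) (simp_all add: simp_ext_meet_def simple_extension_simps(2), (metis meet_le le_refl)+)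

lemma E_lattice: "lattice E"
  by (rule partial_order.latticeI[OF E_partial_order simp_ext_join_bound simp_ext_join_least
        simp_ext_meet_bound simp_ext_meet_greatest])

lemma E_join: "\<lbrakk>x \<in> carrier E; y \<in> carrier E\<rbrakk> \<Longrightarrow> x \<squnion>\<^bsub>E\<^esub> y = simp_ext_join L x y"
  using simp_ext_join_bound[of x y] by (intro lattice.join_eqI[OF E_lattice]) (simp_all add: simp_ext_join_least)

lemma E_meet: "\<lbrakk>x \<in> carrier E; y \<in> carrier E\<rbrakk> \<Longrightarrow> x \<sqinter>\<^bsub>E\<^esub> y = simp_ext_meet L x y"
  using simp_ext_meet_bound[of x y] by (intro lattice.meet_eqI[OF E_lattice]) (simp_all add: simp_ext_meet_greatest)

lemma E_join_In: "\<lbrakk>a \<in> carrier L; b \<in> carrier L\<rbrakk> \<Longrightarrow> In a \<squnion>\<^bsub>E\<^esub> In b = In (a \<squnion> b)"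
  by (simp add: E_join simp_ext_join_def join_absorb join_absorb2 join_idem)

lemma E_meet_In: "\<lbrakk>a \<in> carrier L; b \<in> carrier L\<rbrakk> \<Longrightarrow> In a \<sqinter>\<^bsub>E\<^esub> In b = In (a \<sqinter> b)"
  by (simp add: E_meet simp_ext_meet_def meet_absorb meet_absorb2 meet_idem)

text \<open>Every proper inclusion is pushed to one that starts at \<open>Bot\<close> or ends at
  \<open>Top\<close>; from there the two separators spread the collapse to the whole
  lattice.\<close>

lemma E_simple:
  assumes ne: "carrier L \<noteq> {}" and \<rho>: "lattice_congruence E \<rho>" and st: "(s, t) \<in> \<rho>" "s \<noteq> t"
  shows "(Bot, Top) \<in> \<rho>"
proof -
  interpret E: lattice_cong E \<rho> by (rule lattice_congI[OF E_lattice \<rho>])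
  obtain c where c: "c \<in> carrier L" using ne by blast
  have Bot: "(Bot, Top) \<in> \<rho>" if b: "(Bot, b) \<in> \<rho>" "b \<noteq> Bot" for b
  proof (cases "b = Top")
    case False
    \<comment> \<open>Of the two separators one differs from \<open>b\<close> and has join
      \<open>Top\<close> with it. Meeting the resulting pair with the other separator and with
      \<open>In c\<close> collapses two elements onto \<open>Bot\<close>, and these again join to
      \<open>Top\<close>.\<close>
    obtain i where i: "b \<noteq> Sep i" by (cases "b = Sep True") auto
    have bc: "b \<in> carrier E" "b \<noteq> Sep i" using E.cong_carrier[OF b(1)] i by auto
    have "Bot \<squnion>\<^bsub>E\<^esub> Sep i = Sep i" "b \<squnion>\<^bsub>E\<^esub> Sep i = Top"
      using bc b(2) False by (cases b; simp add: E_join simp_ext_join_def)+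
    with E.cong_join_right[OF b(1), of "Sep i"] have *: "(Sep i, Top) \<in> \<rho>" by simp
    from E.cong_meet_right[OF *, of "Sep (\<not> i)"] E.cong_meet_right[OF *, of "In c"]
    have "(Bot, Sep (\<not> i)) \<in> \<rho>" "(Bot, In c) \<in> \<rho>" using c by (simp_all add: E_meet simp_ext_meet_def)
    from E.cong_join[OF this] show ?thesis using c by (simp add: E_join simp_ext_join_def)
  qed (use b in simp)
  have Top: "(Bot, Top) \<in> \<rho>" if b: "(b, Top) \<in> \<rho>" "b \<noteq> Top" for b
  proof -
    obtain i where i: "b \<noteq> Sep i" by (cases "b = Sep True") auto
    have bc: "b \<in> carrier E" "b \<noteq> Sep i" using E.cong_carrier[OF b(1)] i by auto
    have "Top \<sqinter>\<^bsub>E\<^esub> Sep i = Sep i" "b \<sqinter>\<^bsub>E\<^esub> Sep i = Bot"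
      using bc b(2) by (cases b; simp add: E_meet simp_ext_meet_def)+
    with E.cong_meet_right[OF b(1), of "Sep i"] show ?thesis by (intro Bot[of "Sep i"]) simp_all
  qed
  have le: "(Bot, Top) \<in> \<rho>" if ab: "(a, b) \<in> \<rho>" "a \<noteq> b" and a_le: "a \<sqsubseteq>\<^bsub>E\<^esub> b" for a b
  proof -
    have c: "a \<in> carrier E" "b \<in> carrier E" using E.cong_carrier[OF ab(1)] by auto
    \<comment> \<open>In the three inner cases the auxiliary elements are \<open>Atom x\<close>,
      \<open>Atom y\<close> and \<open>In x\<close>; they turn the pair into
      \<open>(Coat x, Top)\<close>, \<open>(Bot, Atom y)\<close> and \<open>(Bot, In x)\<close>
      respectively.\<close>
    consider "a = Bot" | "b = Top" | x y where "a = In x" "b = In y" "x \<sqsubseteq> y"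
      | x y where "a = In x" "b = Coat y" "x \<sqsubseteq> y" | x where "a = Atom x" "b = Coat x"
      using a_le ab(2) unfolding simple_extension_simps simp_ext_le_def by blast
    then show ?thesis
    proof cases
      case 1
      then show ?thesis using Bot ab by simp
    next
      case 2
      then show ?thesis using Top ab by simp
    next
      case (3 x y)
      then have xy: "x \<in> carrier L" "y \<in> carrier L" "\<not> y \<sqsubseteq> x" using c ab(2) le_antisym by auto
      from E.cong_join_right[OF ab(1), of "Atom x"] have "(Coat x, Top) \<in> \<rho>"
        using 3 xy by (simp add: E_join simp_ext_join_def)
      then show ?thesis by (rule Top) simp
    next
      case (4 x y)
      then have xy: "x \<in> carrier L" "y \<in> carrier L" using c by auto
      from E.cong_meet_right[OF ab(1), of "Atom y"] have "(Bot, Atom y) \<in> \<rho>"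
        using 4 xy by (simp add: E_meet simp_ext_meet_def)
      then show ?thesis by (rule Bot) simp
    next
      case (5 x)
      then have x: "x \<in> carrier L" using c by auto
      from E.cong_meet_right[OF ab(1), of "In x"] have "(Bot, In x) \<in> \<rho>"
        using 5 x by (simp add: E_meet simp_ext_meet_def)
      then show ?thesis by (rule Bot) simp
    qed
  qed
  have c: "s \<in> carrier E" "t \<in> carrier E" using E.cong_carrier[OF st(1)] by auto
  have "s \<sqinter>\<^bsub>E\<^esub> t \<noteq> s \<squnion>\<^bsub>E\<^esub> t"
    using E.meet_eq_join_imp_eq[OF c] st(2) by blast
  with E.cong_meet_join[OF st(1)] show ?thesis using le E.meet_le_join[OF c] by blast
qed

end

section \<open>Transfer along isomorphisms\<close>

text \<open>The order is recovered from joins: \<open>x \<sqsubseteq> y\<close> means that the join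
  of \<open>x\<close> and \<open>y\<close> is \<open>y\<close>, and injectivity reflects this
  equation.\<close>

lemma lattice_hom_le_iff:
  assumes f: "f \<in> lattice_hom L M" "inj_on f (carrier L)" and xy: "x \<in> carrier L" "y \<in> carrier L"
  shows "f x \<sqsubseteq>\<^bsub>M\<^esub> f y \<longleftrightarrow> x \<sqsubseteq>\<^bsub>L\<^esub> y"
proof -
  interpret L: lattice L using f(1) by (simp add: lattice_hom_def join_pres_def)
  interpret M: lattice M using f(1) by (simp add: lattice_hom_def join_pres_def)
  have c: "f x \<in> carrier M" "f y \<in> carrier M" and j: "f (x \<squnion>\<^bsub>L\<^esub> y) = f x \<squnion>\<^bsub>M\<^esub> f y"
    using f(1) xy by (auto simp: lattice_hom_def join_pres_def)
  have "f x \<sqsubseteq>\<^bsub>M\<^esub> f y \<longleftrightarrow> f (x \<squnion>\<^bsub>L\<^esub> y) = f y"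
    unfolding j by (rule M.le_iff_meet[OF c])
  also have "\<dots> \<longleftrightarrow> x \<squnion>\<^bsub>L\<^esub> y = y"
    by (rule inj_on_eq_iff[OF f(2)]) (use xy in simp_all)
  also have "\<dots> \<longleftrightarrow> x \<sqsubseteq>\<^bsub>L\<^esub> y" using L.le_iff_meet[OF xy] by simp
  finally show ?thesis .
qed

lemma restrict_along_congruence:
  assumes f: "f \<in> lattice_hom L M" and \<Psi>: "lattice_congruence M \<Psi>"
  shows "lattice_congruence L (restrict_along L f \<Psi>)"
proof -
  have L: "lattice L" and M: "lattice M" using f by (simp_all add: lattice_hom_def join_pres_def)
  have \<Psi>': "lattice_cong M \<Psi>" by (rule lattice_congI[OF M \<Psi>])
  have fc: "f x \<in> carrier M" if "x \<in> carrier L" for x using f that by (auto simp: lattice_hom_def)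
  have fj: "f (x \<squnion>\<^bsub>L\<^esub> y) = f x \<squnion>\<^bsub>M\<^esub> f y" "f (x \<sqinter>\<^bsub>L\<^esub> y) = f x \<sqinter>\<^bsub>M\<^esub> f y"
    if "x \<in> carrier L" "y \<in> carrier L" for x y
    using f that by (auto simp: lattice_hom_def join_pres_def meet_pres_def)
  interpret L: lattice L by (rule L)
  show ?thesis
  proof (rule lattice_congruenceI[OF L])
    show "equiv (carrier L) (restrict_along L f \<Psi>)"
      unfolding restrict_along_def
      using fc lattice_cong.cong_refl[OF \<Psi>'] lattice_cong.cong_sym[OF \<Psi>'] lattice_cong.cong_trans[OF \<Psi>']
      by (intro equivI refl_onI symI transI) blast+
    fix x y w assume "(x, y) \<in> restrict_along L f \<Psi>" and w: "w \<in> carrier L"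
    then have xy: "x \<in> carrier L" "y \<in> carrier L" "(f x, f y) \<in> \<Psi>" by (auto simp: restrict_along_def)
    show "(x \<squnion>\<^bsub>L\<^esub> w, y \<squnion>\<^bsub>L\<^esub> w) \<in> restrict_along L f \<Psi>"
      using lattice_cong.cong_join_right[OF \<Psi>' xy(3) fc[OF w]] xy(1,2) w
      by (simp add: restrict_along_def fj)
    show "(x \<sqinter>\<^bsub>L\<^esub> w, y \<sqinter>\<^bsub>L\<^esub> w) \<in> restrict_along L f \<Psi>"
      using lattice_cong.cong_meet_right[OF \<Psi>' xy(3) fc[OF w]] xy(1,2) w
      by (simp add: restrict_along_def fj)
  qed
qed

locale lattice_iso =
  fixes L :: "('a, 'm) gorder_scheme" and N :: "('b, 'n) gorder_scheme" and g
  assumes hom: "g \<in> lattice_hom L N" and bij: "bij_betw g (carrier L) (carrier N)"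
begin

definition ginv where "ginv = inv_into (carrier L) g"

lemma L_lattice: "lattice L" and N_lattice: "lattice N"
  using hom by (simp_all add: lattice_hom_def join_pres_def)

lemma g_closed: "x \<in> carrier L \<Longrightarrow> g x \<in> carrier N"
  using bij by (auto dest: bij_betwE)

lemma ginv_closed: "y \<in> carrier N \<Longrightarrow> ginv y \<in> carrier L"
  using bij unfolding ginv_def by (metis bij_betw_def inv_into_into)

lemma g_ginv: "y \<in> carrier N \<Longrightarrow> g (ginv y) = y"
  using bij unfolding ginv_def by (metis bij_betw_inv_into_right)

lemma ginv_g: "x \<in> carrier L \<Longrightarrow> ginv (g x) = x"
  using bij unfolding ginv_def by (metis bij_betw_inv_into_left)

lemma g_le: "\<lbrakk>x \<in> carrier L; y \<in> carrier L\<rbrakk> \<Longrightarrow> g x \<sqsubseteq>\<^bsub>N\<^esub> g y \<longleftrightarrow> x \<sqsubseteq>\<^bsub>L\<^esub> y"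
  using lattice_hom_le_iff[OF hom] bij by (simp add: bij_betw_def)

lemma ginv_le: "\<lbrakk>x \<in> carrier N; y \<in> carrier N\<rbrakk> \<Longrightarrow> ginv x \<sqsubseteq>\<^bsub>L\<^esub> ginv y \<longleftrightarrow> x \<sqsubseteq>\<^bsub>N\<^esub> y"
  using g_le[of "ginv x" "ginv y"] by (simp add: ginv_closed g_ginv)

lemma ginv_hom: "ginv \<in> lattice_hom N L"
proof (rule order_iso_lattice_hom[OF N_lattice L_lattice _ ginv_le])
  show "bij_betw ginv (carrier N) (carrier L)"
    unfolding ginv_def by (rule bij_betw_inv_into[OF bij])
qed

text \<open>\<open>ginv\<close> carries the classes of a congruence of \<open>N\<close> to classes
  of its restriction along \<open>g\<close>; an isomorphism between the latter is conjugated back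
  with \<open>g\<close>.\<close>

lemma isoform_transfer:
  assumes iso: "isoform L"
  shows "isoform N"
  unfolding isoform_def isoform_congruence_def
proof (intro allI impI ballI)
  fix \<Psi> A' B' assume \<Psi>: "lattice_congruence N \<Psi>" and AB': "A' \<in> carrier N // \<Psi>" "B' \<in> carrier N // \<Psi>"
  define \<Theta> where "\<Theta> = restrict_along L g \<Psi>"
  have \<Theta>: "lattice_congruence L \<Theta>" unfolding \<Theta>_def by (rule restrict_along_congruence[OF hom \<Psi>])
  have class_sub: "A \<subseteq> carrier N" if "A \<in> carrier N // \<Psi>" for A
    using that \<Psi> by (metis Union_quotient Union_upper lattice_congruence_def)
  have pre: "ginv ` A \<in> carrier L // \<Theta>" if A: "A \<in> carrier N // \<Psi>" for A
  proof -
    from A obtain a where a: "a \<in> carrier N" "A = \<Psi> `` {a}" by (rule quotientE)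
    have "ginv ` A = \<Theta> `` {ginv a}"
    proof (intro equalityI subsetI)
      fix x assume "x \<in> ginv ` A"
      then obtain y where y: "y \<in> A" "x = ginv y" by blast
      then have "y \<in> carrier N" using class_sub[OF A] by blast
      then show "x \<in> \<Theta> `` {ginv a}" using y a by (simp add: \<Theta>_def restrict_along_def ginv_closed g_ginv)
    next
      fix x assume "x \<in> \<Theta> `` {ginv a}"
      then have "x \<in> carrier L" "g x \<in> A" using a by (auto simp: \<Theta>_def restrict_along_def g_ginv)
      then show "x \<in> ginv ` A" using ginv_g by (metis imageI)
    qed
    then show ?thesis using a by (simp add: quotientI ginv_closed)
  qed
  define A B where "A = ginv ` A'" and "B = ginv ` B'"
  have AB: "A \<in> carrier L // \<Theta>" "B \<in> carrier L // \<Theta>" unfolding A_def B_def by (rule pre AB')+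
  have sub: "A \<subseteq> carrier L" "B \<subseteq> carrier L"
    unfolding A_def B_def using class_sub[OF AB'(1)] class_sub[OF AB'(2)] ginv_closed by blast+
  obtain f where f: "f \<in> lattice_hom (L\<lparr>carrier := A\<rparr>) (L\<lparr>carrier := B\<rparr>)" "bij_betw f A B"
    using iso \<Theta> AB unfolding isoform_def isoform_congruence_def lattice_isomorphic_def by force
  have f_le: "f x \<sqsubseteq>\<^bsub>L\<^esub> f y \<longleftrightarrow> x \<sqsubseteq>\<^bsub>L\<^esub> y" if "x \<in> A" "y \<in> A" for x y
    using lattice_hom_le_iff[OF f(1), of x y] that f(2) by (simp add: bij_betw_def)
  have bA: "bij_betw ginv A' A"
    unfolding A_def by (rule inj_on_imp_bij_betw) (metis class_sub[OF AB'(1)] g_ginv inj_onI subsetD)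
  have "inj_on g B" using bij sub(2) by (metis bij_betw_def inj_on_subset)
  moreover have "g ` B = B'" unfolding B_def using class_sub[OF AB'(2)] by (force simp: g_ginv)
  ultimately have bB: "bij_betw g B B'" by (simp add: bij_betw_def)
  have fB: "f x \<in> B" if "x \<in> A" for x using f(2) that by (auto dest: bij_betwE)
  have ginvA: "ginv x \<in> A" if "x \<in> A'" for x using that by (simp add: A_def)
  have b: "bij_betw (g \<circ> (f \<circ> ginv)) A' B'"
    by (rule bij_betw_trans[OF bij_betw_trans[OF bA f(2)] bB])
  have le: "(g \<circ> (f \<circ> ginv)) x \<sqsubseteq>\<^bsub>N\<^esub> (g \<circ> (f \<circ> ginv)) y \<longleftrightarrow> x \<sqsubseteq>\<^bsub>N\<^esub> y" if xy: "x \<in> A'" "y \<in> A'" for x y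
  proof -
    have "f (ginv x) \<in> carrier L" "f (ginv y) \<in> carrier L" using fB[OF ginvA] sub(2) xy by blast+
    then show ?thesis
      using g_le f_le[OF ginvA[OF xy(1)] ginvA[OF xy(2)]] ginv_le[of x y] class_sub[OF AB'(1)] xy
      by auto
  qed
  have "g \<circ> (f \<circ> ginv) \<in> lattice_hom (N\<lparr>carrier := A'\<rparr>) (N\<lparr>carrier := B'\<rparr>)"
    by (rule order_iso_lattice_hom[OF congruence_class_sublattice(1)[OF N_lattice \<Psi> AB'(1)]
          congruence_class_sublattice(1)[OF N_lattice \<Psi> AB'(2)]]) (use b le in simp_all)
  then show "lattice_isomorphic (N\<lparr>carrier := A'\<rparr>) (N\<lparr>carrier := B'\<rparr>)"
    unfolding lattice_isomorphic_def by (rule bexI[rotated]) (use b in simp)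
qed

text \<open>Restriction along \<open>g\<close> and along \<open>ginv\<close> are mutually inverse
  maps between the congruences of \<open>N\<close> and those of \<open>L\<close>, compatible with
  restriction to \<open>K\<close>; unique extension is therefore carried over.\<close>

lemma congruence_preserving_extension_transfer:
  fixes K :: "('c, 'k) gorder_scheme"
  assumes ext: "congruence_preserving_extension K L"
  shows "congruence_preserving_extension K N"
proof -
  obtain f where f: "lattice_embedding K L f"
    and ex1: "\<And>\<Theta>. lattice_congruence K \<Theta> \<Longrightarrow> \<exists>!\<Psi>. lattice_congruence L \<Psi> \<and> restrict_along K f \<Psi> = \<Theta>"
    using ext unfolding congruence_preserving_extension_def by blast
  have fc: "f x \<in> carrier L" if "x \<in> carrier K" for x
    using f that by (auto simp: lattice_embedding_def lattice_hom_def)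
  have emb: "lattice_embedding K N (g \<circ> f)"
    unfolding lattice_embedding_def
  proof
    show "g \<circ> f \<in> lattice_hom K N"
      using f hom fc by (auto simp: lattice_embedding_def lattice_hom_def join_pres_def meet_pres_def g_closed)
    show "inj_on (g \<circ> f) (carrier K)"
      using f fc bij unfolding lattice_embedding_def
      by (metis bij_betw_def comp_inj_on image_subsetI inj_on_subset)
  qed
  have comp: "restrict_along K (g \<circ> f) \<Psi> = restrict_along K f (restrict_along L g \<Psi>)" for \<Psi>
    using fc by (auto simp: restrict_along_def)
  have push_pull: "restrict_along L g (restrict_along N ginv \<Psi>) = \<Psi>" if "lattice_congruence L \<Psi>" for \<Psi>
    using lattice_cong.cong_carrier[OF lattice_congI[OF L_lattice that]]
    by (auto simp: restrict_along_def g_closed ginv_g)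
  have pull_push: "restrict_along N ginv (restrict_along L g \<Psi>) = \<Psi>" if "lattice_congruence N \<Psi>" for \<Psi>
    using lattice_cong.cong_carrier[OF lattice_congI[OF N_lattice that]]
    by (auto simp: restrict_along_def ginv_closed g_ginv)
  have "\<exists>!\<Psi>. lattice_congruence N \<Psi> \<and> restrict_along K (g \<circ> f) \<Psi> = \<Theta>"
    if \<Theta>: "lattice_congruence K \<Theta>" for \<Theta>
  proof -
    obtain \<Psi> where \<Psi>: "lattice_congruence L \<Psi>" "restrict_along K f \<Psi> = \<Theta>"
      and uniq: "\<And>\<Psi>'. lattice_congruence L \<Psi>' \<Longrightarrow> restrict_along K f \<Psi>' = \<Theta> \<Longrightarrow> \<Psi>' = \<Psi>"
      using ex1[OF \<Theta>] by blast
    show ?thesis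
    proof (intro ex1I conjI)
      show "lattice_congruence N (restrict_along N ginv \<Psi>)"
        by (rule restrict_along_congruence[OF ginv_hom \<Psi>(1)])
      show "restrict_along K (g \<circ> f) (restrict_along N ginv \<Psi>) = \<Theta>"
        by (simp add: comp push_pull \<Psi>)
      fix \<Psi>' assume \<Psi>': "lattice_congruence N \<Psi>' \<and> restrict_along K (g \<circ> f) \<Psi>' = \<Theta>"
      then have "restrict_along L g \<Psi>' = \<Psi>"
        using restrict_along_congruence[OF hom] by (intro uniq) (simp_all add: comp)
      then show "\<Psi>' = restrict_along N ginv \<Psi>" using pull_push \<Psi>' by blast
    qed
  qed
  with emb show ?thesis unfolding congruence_preserving_extension_def by blast
qed

end

text \<open>The order is transported along an injection into the natural numbers, bringing a lattice
  on any type to the fixed type \<open>nat\<close>.\<close>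

lemma finite_lattice_nat_copy:
  assumes L: "lattice L" and fin: "finite (carrier L)"
  obtains N :: "nat gorder" and g where "lattice_iso L N g"
proof -
  obtain g :: "'a \<Rightarrow> nat" and n where g: "g ` carrier L = {i. i < n}" "inj_on g (carrier L)"
    using finite_imp_inj_to_nat_seg[OF fin] by blast
  define N :: "nat gorder" where "N = \<lparr>carrier = g ` carrier L, eq = (=),
    le = (\<lambda>a b. inv_into (carrier L) g a \<sqsubseteq>\<^bsub>L\<^esub> inv_into (carrier L) g b)\<rparr>"
  have bij: "bij_betw g (carrier L) (carrier N)" using g by (simp add: bij_betw_def N_def)
  have le: "g x \<sqsubseteq>\<^bsub>N\<^esub> g y \<longleftrightarrow> x \<sqsubseteq>\<^bsub>L\<^esub> y" if "x \<in> carrier L" "y \<in> carrier L" for x y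
    using that g(2) by (simp add: N_def)
  have gc: "g x \<in> carrier N" if "x \<in> carrier L" for x
    using that by (simp add: N_def)
  have carN: "\<exists>x\<in>carrier L. a = g x" if "a \<in> carrier N" for a using that by (auto simp: N_def)
  interpret L: lattice L by (rule L)
  have po: "partial_order N"
  proof (rule partial_orderI_eq)
    show "eq N = (=)" by (simp add: N_def)
    show "a \<sqsubseteq>\<^bsub>N\<^esub> a" if "a \<in> carrier N" for a
      using carN[OF that] le by auto
    show "a = b" if "a \<in> carrier N" "b \<in> carrier N" "a \<sqsubseteq>\<^bsub>N\<^esub> b" "b \<sqsubseteq>\<^bsub>N\<^esub> a" for a b
      using carN[OF that(1)] carN[OF that(2)] that(3,4) le L.le_antisym by metis
    show "a \<sqsubseteq>\<^bsub>N\<^esub> c" if "a \<in> carrier N" "b \<in> carrier N" "c \<in> carrier N" "a \<sqsubseteq>\<^bsub>N\<^esub> b" "b \<sqsubseteq>\<^bsub>N\<^esub> c" for a b c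
      using carN[OF that(1)] carN[OF that(2)] carN[OF that(3)] that(4,5) le L.le_trans by metis
  qed
  let ?h = "inv_into (carrier L) g"
  have h: "?h a \<in> carrier L \<and> g (?h a) = a" if "a \<in> carrier N" for a
    using that by (auto simp: N_def inv_into_into f_inv_into_f)
  have N: "lattice N"
  proof (rule partial_order.latticeI[OF po])
    fix a b assume ab: "a \<in> carrier N" "b \<in> carrier N"
    note hab = h[OF ab(1)] h[OF ab(2)]
    have N_le: "g x \<in> carrier N" "a \<sqsubseteq>\<^bsub>N\<^esub> g x \<longleftrightarrow> ?h a \<sqsubseteq>\<^bsub>L\<^esub> x" "b \<sqsubseteq>\<^bsub>N\<^esub> g x \<longleftrightarrow> ?h b \<sqsubseteq>\<^bsub>L\<^esub> x"
      "g x \<sqsubseteq>\<^bsub>N\<^esub> a \<longleftrightarrow> x \<sqsubseteq>\<^bsub>L\<^esub> ?h a" "g x \<sqsubseteq>\<^bsub>N\<^esub> b \<longleftrightarrow> x \<sqsubseteq>\<^bsub>L\<^esub> ?h b" if "x \<in> carrier L" for x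
      using le[of "?h a" x] le[of "?h b" x] le[of x "?h a"] le[of x "?h b"] hab that gc by auto
    show "g (?h a \<squnion>\<^bsub>L\<^esub> ?h b) \<in> carrier N \<and> a \<sqsubseteq>\<^bsub>N\<^esub> g (?h a \<squnion>\<^bsub>L\<^esub> ?h b) \<and> b \<sqsubseteq>\<^bsub>N\<^esub> g (?h a \<squnion>\<^bsub>L\<^esub> ?h b)"
      using hab by (simp add: N_le L.join_left L.join_right)
    show "g (?h a \<sqinter>\<^bsub>L\<^esub> ?h b) \<in> carrier N \<and> g (?h a \<sqinter>\<^bsub>L\<^esub> ?h b) \<sqsubseteq>\<^bsub>N\<^esub> a \<and> g (?h a \<sqinter>\<^bsub>L\<^esub> ?h b) \<sqsubseteq>\<^bsub>N\<^esub> b"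
      using hab by (simp add: N_le L.meet_left L.meet_right)
    fix w assume w: "w \<in> carrier N"
    obtain x where x: "x \<in> carrier L" "w = g x" using carN[OF w] by blast
    show "g (?h a \<squnion>\<^bsub>L\<^esub> ?h b) \<sqsubseteq>\<^bsub>N\<^esub> w" if "a \<sqsubseteq>\<^bsub>N\<^esub> w" "b \<sqsubseteq>\<^bsub>N\<^esub> w"
      using that hab x by (simp add: N_le le L.join_le)
    show "w \<sqsubseteq>\<^bsub>N\<^esub> g (?h a \<sqinter>\<^bsub>L\<^esub> ?h b)" if "w \<sqsubseteq>\<^bsub>N\<^esub> a" "w \<sqsubseteq>\<^bsub>N\<^esub> b"
      using that hab x by (simp add: N_le le L.meet_le)
  qed
  have "lattice_iso L N g"
    using order_iso_lattice_hom[OF L N bij le] bij by (rule lattice_iso.intro)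
  then show thesis by (rule that)
qed

section \<open>The isoform extension\<close>

theorem theorem2:
  fixes K :: "'a gorder"
  assumes "finite_lattice K"
  shows "\<exists>L :: nat gorder. finite_lattice L \<and> isoform L \<and> congruence_preserving_extension K L"
proof -
  have K: "lattice K" and fin: "finite (carrier K)" and ne: "carrier K \<noteq> {}"
    using assms by (auto simp: finite_lattice_def)
  interpret K: lattice K by (rule K)

  \<comment> \<open>The pruned product attached to \<open>K\<close>\<close>
  define M where "M = meet_prime_congruences K"
  \<comment> \<open>With this orientation a collapse at \<open>p\<close> forces one at every smaller
    \<open>q\<close>, and the sets closed under predecessors are the up-sets of
    \<open>M\<close>.\<close>
  define R where "R = {(p, q) \<in> M \<times> M. q \<subset> p}"
  define A where "A = (\<lambda>p. simple_extension (quotient_lattice K p))"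
  have M_cong: "lattice_congruence K p" if "p \<in> M" for p
    using that by (simp add: M_def meet_prime_congruences_def)
  have con: "lattice_cong K p" if "p \<in> M" for p by (rule lattice_congI[OF K M_cong[OF that]])
  have M_sub: "p \<subseteq> carrier K \<times> carrier K" if "p \<in> M" for p
    using lattice_cong.cong_carrier[OF con[OF that]] by auto
  have fin_M: "finite M"
    by (rule finite_subset[of _ "Pow (carrier K \<times> carrier K)"]) (use M_sub fin in auto)
  have Q: "lattice (quotient_lattice K p)" if "p \<in> M" for p
    by (rule lattice_cong.Q_lattice[OF con[OF that]])
  have "wf R"
  proof (rule finite_acyclic_wf)
    show "finite R" by (rule finite_subset[of _ "M \<times> M"]) (use fin_M in \<open>auto simp: R_def\<close>)
    have "q \<subset> p" if "(p, q) \<in> R\<^sup>+" for p q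
      using that by (induction rule: trancl_induct) (auto simp: R_def)
    then show "acyclic R" by (auto simp: acyclic_def)
  qed
  \<comment> \<open>\<open>Sep True\<close> acts as the pruning value; \<open>Sep False\<close> is
    its partner in the proof that the factors are simple.\<close>
  interpret simple_pruned_product M R A "\<lambda>_. Sep True" "\<lambda>_. Bot" "\<lambda>_. Top"
  proof (intro simple_pruned_product.intro pruned_product.intro simple_pruned_product_axioms.intro)
    show "lattice (A p)" if "p \<in> M" for p
      unfolding A_def by (rule lattice.E_lattice[OF Q[OF that]])
    show "R \<subseteq> M \<times> M" by (auto simp: R_def)
    show "(Bot, Top) \<in> \<rho>" if "p \<in> M" "lattice_congruence (A p) \<rho>" "(s, t) \<in> \<rho>" "s \<noteq> t" for p \<rho> s t
      using lattice.E_simple[OF Q[OF that(1)]] that ne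
      unfolding A_def by (simp add: quotient_lattice_def)
  qed (auto simp: A_def simple_extension_simps(2) fin_M \<open>wf R\<close>)
  have finP: "finite (carrier P)"
    unfolding pruned_def A_def
    by (auto intro!: finite_PiE simp: fin_M simple_extension_simps(1) quotient_lattice_def fin)

  \<comment> \<open>The diagonal embedding\<close>
  define f where "f x = (\<lambda>p\<in>M. In (class_rep p x))" for x
  have Q_mem: "class_rep p x \<in> carrier (quotient_lattice K p)" if "x \<in> carrier K" for p x
    using that by (simp add: quotient_lattice_def)
  have f_closed: "f x \<in> carrier P" if "x \<in> carrier K" for x
    using that unfolding P_carrier by (auto simp: f_def A_def Q_mem)
  have f_eq: "f x p = f y p \<longleftrightarrow> (x, y) \<in> p" if "p \<in> M" "x \<in> carrier K" "y \<in> carrier K" for x y p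
    using that lattice_cong.rep_eq_iff[OF con[OF that(1)]] by (simp add: f_def)
  have "f \<in> lattice_hom K P"
    unfolding lattice_hom_def join_pres_def meet_pres_def
  proof (intro CollectI conjI ballI K P_lattice)
    show "f \<in> carrier K \<rightarrow> carrier P" using f_closed by blast
    fix x y assume xy: "x \<in> carrier K" "y \<in> carrier K"
    show "f (x \<squnion>\<^bsub>K\<^esub> y) = f x \<squnion>\<^bsub>P\<^esub> f y"
    \<comment> \<open>All coordinates of \<open>f\<close> have the form \<open>In _\<close>, so they
      never equal the separator.\<close>
    proof (rule P_join_componentwise[symmetric])
      show "\<forall>p\<in>M. f x p \<squnion>\<^bsub>A p\<^esub> f y p = f (x \<squnion>\<^bsub>K\<^esub> y) p"
        using xy by (simp add: f_def A_def lattice.E_join_In[OF Q] Q_mem lattice_cong.Q_join[OF con])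
    qed (use xy in \<open>simp_all add: f_closed\<close>, simp add: f_def)
    show "f (x \<sqinter>\<^bsub>K\<^esub> y) = f x \<sqinter>\<^bsub>P\<^esub> f y"
    proof (rule P_meet_componentwise[symmetric])
      show "\<forall>p\<in>M. f x p \<sqinter>\<^bsub>A p\<^esub> f y p = f (x \<sqinter>\<^bsub>K\<^esub> y) p"
        using xy by (simp add: f_def A_def lattice.E_meet_In[OF Q] Q_mem lattice_cong.Q_meet[OF con])
    qed (use xy in \<open>simp_all add: f_closed\<close>, simp add: f_def)
  qed
  \<comment> \<open>\<open>\<Theta>\<close> is the intersection of the members of \<open>M\<close>
    above it, and agreement at \<open>p\<close> means congruence modulo \<open>p\<close>. Taking the
    identity for \<open>\<Theta>\<close> gives injectivity.\<close>
  moreover have sep: "(x, y) \<in> \<Theta>"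
    if \<Theta>: "lattice_congruence K \<Theta>" and xy: "x \<in> carrier K" "y \<in> carrier K"
      and all: "\<forall>p\<in>M. \<Theta> \<subseteq> p \<longrightarrow> f x p = f y p" for \<Theta> x y
  proof (rule ccontr)
    assume "(x, y) \<notin> \<Theta>"
    then obtain p where "p \<in> M" "\<Theta> \<subseteq> p" "(x, y) \<notin> p"
      using lattice_cong.meet_prime_congruence_separates[OF lattice_congI[OF K \<Theta>] fin xy]
      unfolding M_def by blast
    then show False using all f_eq xy by blast
  qed
  moreover have "inj_on f (carrier K)"
  proof (rule inj_onI)
    fix x y assume xy: "x \<in> carrier K" "y \<in> carrier K" "f x = f y"
    have "lattice_congruence K (Id_on (carrier K))"
      by (auto simp: lattice_congruence_def equiv_def refl_on_def sym_def trans_def)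
    from sep[OF this xy(1,2)] xy(3) show "x = y" by auto
  qed
  ultimately have emb: "lattice_embedding K P f" by (simp add: lattice_embedding_def)

  \<comment> \<open>Unique extension of congruences\<close>
  have "\<exists>!\<Psi>. lattice_congruence P \<Psi> \<and> restrict_along K f \<Psi> = \<Theta>" if \<Theta>: "lattice_congruence K \<Theta>" for \<Theta>
  proof -
    define J where "J = {p \<in> M. \<Theta> \<subseteq> p}"
    have restr: "restrict_along K f (agree P J') = carrier K \<times> carrier K \<inter> \<Inter>J'" if J': "J' \<subseteq> M" for J'
    proof -
      have "(f x, f y) \<in> agree P J' \<longleftrightarrow> (x, y) \<in> \<Inter>J'" if "x \<in> carrier K" "y \<in> carrier K" for x y
        using f_eq[OF subsetD[OF J'] that] f_closed that by (simp add: agree_def)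
      then show ?thesis by (auto simp only: restrict_along_def)
    qed
    have \<Theta>_carrier: "\<Theta> \<subseteq> carrier K \<times> carrier K"
      using lattice_cong.cong_carrier[OF lattice_congI[OF K \<Theta>]] by auto
    have J: "J \<subseteq> M" "\<forall>p q. (p, q) \<in> R \<longrightarrow> q \<in> J \<longrightarrow> p \<in> J"
      by (auto simp: J_def R_def)
    have restr_J: "restrict_along K f (agree P J) = \<Theta>"
    proof
      show "restrict_along K f (agree P J) \<subseteq> \<Theta>"
        using sep[OF \<Theta>] by (auto simp: restrict_along_def agree_def J_def)
      show "\<Theta> \<subseteq> restrict_along K f (agree P J)"
        unfolding restr[OF J(1)] using \<Theta>_carrier by (auto simp: J_def)
    qed
    show ?thesis
    proof (intro ex1I conjI)
      show "lattice_congruence P (agree P J)" by (rule agree_cong[OF J])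
      show "restrict_along K f (agree P J) = \<Theta>" by (rule restr_J)
      fix \<Psi> assume \<Psi>: "lattice_congruence P \<Psi> \<and> restrict_along K f \<Psi> = \<Theta>"
      then obtain J' where J': "J' \<subseteq> M" "\<forall>p q. (p, q) \<in> R \<longrightarrow> q \<in> J' \<longrightarrow> p \<in> J'" "\<Psi> = agree P J'"
        using cong_eq_agree[of \<Psi>] by blast
      then have \<Theta>_eq: "\<Theta> = carrier K \<times> carrier K \<inter> \<Inter>J'" using \<Psi> restr by simp
      have "J' = J"
      proof
        show "J' \<subseteq> J" using J'(1) \<Theta>_eq by (auto simp: J_def)
        \<comment> \<open>A member \<open>p\<close> of \<open>J\<close> contains the intersection of
          \<open>J'\<close>, so by meet-primeness it lies above some \<open>q \<in> J'\<close>; as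
          \<open>J'\<close> is an up-set, it contains \<open>p\<close>.\<close>
        show "J \<subseteq> J'"
        proof
          fix p assume p: "p \<in> J"
          then have pM: "p \<in> M" and sub: "carrier K \<times> carrier K \<inter> \<Inter>J' \<subseteq> p" using \<Theta>_eq by (auto simp: J_def)
          obtain q where q: "q \<in> J'" "q \<subseteq> p"
            using meet_prime_congruence_Inter[OF pM[unfolded M_def] _ sub] M_cong J'(1) by blast
          show "p \<in> J'"
          proof (cases "q = p")
            case False
            then have "(p, q) \<in> R" using q J'(1) pM by (auto simp: R_def)
            then show ?thesis using J'(2) q(1) by blast
          qed (use q in simp)
        qed
      qed
      then show "\<Psi> = agree P J" using J'(3) by simp
    qed
  qed
  with emb have cpe: "congruence_preserving_extension K P"
    unfolding congruence_preserving_extension_def by blast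

  \<comment> \<open>Transfer to natural numbers\<close>
  obtain N :: "nat gorder" and g where "lattice_iso P N g"
    using finite_lattice_nat_copy[OF P_lattice finP] .
  then interpret N: lattice_iso P N g .
  have "finite_lattice N"
    using N.N_lattice N.bij finP zero_closed N.g_closed
    by (auto simp: finite_lattice_def dest: bij_betw_finite)
  then show ?thesis
    using N.isoform_transfer[OF P_isoform] N.congruence_preserving_extension_transfer[OF cpe] by blast
qed

end
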